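(* Let $k$ be a field and, for $n\ge2$, let $D_n$ be the rank $2^{n-1}$ free differential module of degree $2$ over the standard graded polynomial ring $k[x_1,\dots,x_n]$ defined inductively as follows. $D_2$ is the free module of rank $2$ over $k[x_1,x_2]$ with differential given by the matrix $\begin{pmatrix} x_1x_2 & -x_2^2 \\ {x_1^2} & -x_1x_2 \end{pmatrix}$. For $n\ge3$, writing $R=k[x_1,\dots,x_{n-1}]$, $S=k[x_1,\dots,x_n]$ and $d$ for the differential of $D_{n-1}$, set $D_n=(D_{n-1}\otimes_RS)\oplus(D_{n-1}\otimes_RS(1))$ with differential given by the block matrix $\begin{pmatrix} -d\otimes_RS & x_n\operatorname{id} \\ 0 & d\otimes_RS \end{pmatrix}$. Then $D_n$ is a minimal free resolution of a differential module with homology $k$.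
   Context: A degree $a$ differential $S$-module is a graded $S$-module $D$ with a homogeneous $S$-linear map $d\colon D\to D(a)$ that squares to zero; $H(D)=\ker(d)/\operatorname{im}(d(-a))$. Morphisms are $S$-linear maps commuting with the differentials; a quasi-isomorphism is a morphism inducing an isomorphism on homology. A free differential module $M$ is minimal if $d^M\otimes_Sk=0$. A free flag is a differential module $F$ with a splitting $F=\bigoplus_{i\ge0}F_i$ into free modules such that $d(F_i)\subseteq\bigoplus_{j<i}F_j$. A free flag resolution of $D$ is a free flag $F$ with a quasi-isomorphism $F\to D$. A minimal free resolution of $D$ is a quasi-isomorphism $M\to D$ that factors as $M\to F\to D$ through a free flag resolution $F\to D$, where $M\to F$ is a split injection of differential modules and $M$ is minimal. *)

theory Defs
  imports
    "HOL-Algebra.AbelCoset"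
    "HOL-Algebra.Generated_Groups"
    "HOL-Algebra.Module"
    "HOL-Library.Poly_Mapping"
    "Jordan_Normal_Form.Matrix"
begin

section \<open>The standard graded polynomial ring\<close>

text \<open>A monomial is a finitely supported exponent vector. All the rings
  \<open>k[x\<^sub>1,\<dots>,x\<^sub>n]\<close> are subrings of one ring in variables indexed by \<open>nat\<close>, so extension of
  scalars of a matrix from \<open>k[x\<^sub>1,\<dots>,x\<^bsub>n-1\<^esub>]\<close> to \<open>k[x\<^sub>1,\<dots>,x\<^sub>n]\<close> leaves its entries unchanged.\<close>

type_synonym 'k mpoly = "(nat \<Rightarrow>\<^sub>0 nat) \<Rightarrow>\<^sub>0 'k"

definition Var :: "nat \<Rightarrow> 'k::field mpoly" where
  "Var i = Poly_Mapping.single (Poly_Mapping.single i 1) 1"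

definition Poly_Ring :: "nat \<Rightarrow> 'k::field mpoly ring" where
  "Poly_Ring n = \<lparr>carrier = {p. \<forall>m \<in> Poly_Mapping.keys p. Poly_Mapping.keys m \<subseteq> {1..n}},
     monoid.mult = (*), one = 1, zero = 0, add = (+)\<rparr>"

definition monom_degree :: "(nat \<Rightarrow>\<^sub>0 nat) \<Rightarrow> nat" where
  "monom_degree m = (\<Sum>i \<in> Poly_Mapping.keys m. Poly_Mapping.lookup m i)"

definition Poly_deg :: "nat \<Rightarrow> int \<Rightarrow> 'k::field mpoly set" where
  "Poly_deg n j = {p \<in> carrier (Poly_Ring n). \<forall>m \<in> Poly_Mapping.keys p. int (monom_degree m) = j}"

definition const_coeff :: "'k::field mpoly \<Rightarrow> 'k" where
  "const_coeff p = Poly_Mapping.lookup p 0"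

text \<open>The homogeneous maximal ideal of \<open>S = k[x\<^sub>1,\<dots>,x\<^sub>n]\<close>, i.e. the kernel of the surjection onto \<open>k\<close>.\<close>

definition max_ideal :: "nat \<Rightarrow> 'k::field mpoly set" where
  "max_ideal n = {p \<in> carrier (Poly_Ring n). const_coeff p = 0}"


section \<open>Graded modules\<close>

record ('r, 'm) gmod = "('r, 'm) module" +
  deg_part :: "int \<Rightarrow> 'm set"

text \<open>Every element is uniquely a finite sum of components, one from each of the sets \<open>A i\<close>.\<close>

definition is_direct_sum :: "('r, 'm, 'e) module_scheme \<Rightarrow> ('i \<Rightarrow> 'm set) \<Rightarrow> bool" where
  "is_direct_sum M A \<longleftrightarrow>
     (\<forall>i. subgroup (A i) (add_monoid M)) \<and>
     (\<forall>x \<in> carrier M. \<exists>!f. (\<forall>i. f i \<in> A i) \<and> finite {i. f i \<noteq> \<zero>\<^bsub>M\<^esub>} \<and>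
        x = finsum M f {i. f i \<noteq> \<zero>\<^bsub>M\<^esub>})"

definition graded_module :: "nat \<Rightarrow> ('k::field mpoly, 'm, 'e) gmod_scheme \<Rightarrow> bool" where
  "graded_module n M \<longleftrightarrow>
     module (Poly_Ring n) M \<and> is_direct_sum M (deg_part M) \<and>
     (\<forall>i j. \<forall>r \<in> Poly_deg n i. \<forall>x \<in> deg_part M j. r \<odot>\<^bsub>M\<^esub> x \<in> deg_part M (i + j))"

definition twist :: "int \<Rightarrow> ('r, 'm, 'e) gmod_scheme \<Rightarrow> ('r, 'm, 'e) gmod_scheme" where
  "twist a M = M\<lparr>deg_part := \<lambda>j. deg_part M (j + a)\<rparr>"

definition linear_map ::
  "nat \<Rightarrow> ('k::field mpoly, 'm, 'e) module_scheme \<Rightarrow> ('k mpoly, 'n, 'f) module_scheme \<Rightarrow>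
    ('m \<Rightarrow> 'n) \<Rightarrow> bool" where
  "linear_map n M N f \<longleftrightarrow>
     f \<in> carrier M \<rightarrow> carrier N \<and>
     (\<forall>x \<in> carrier M. \<forall>y \<in> carrier M. f (x \<oplus>\<^bsub>M\<^esub> y) = f x \<oplus>\<^bsub>N\<^esub> f y) \<and>
     (\<forall>r \<in> carrier (Poly_Ring n). \<forall>x \<in> carrier M. f (r \<odot>\<^bsub>M\<^esub> x) = r \<odot>\<^bsub>N\<^esub> f x)"

definition graded_hom ::
  "nat \<Rightarrow> ('k::field mpoly, 'm, 'e) gmod_scheme \<Rightarrow> ('k mpoly, 'n, 'f) gmod_scheme \<Rightarrow>
    ('m \<Rightarrow> 'n) \<Rightarrow> bool" where
  "graded_hom n M N f \<longleftrightarrow>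
     linear_map n M N f \<and> (\<forall>j. \<forall>x \<in> deg_part M j. f x \<in> deg_part N j)"

definition graded_iso ::
  "nat \<Rightarrow> ('k::field mpoly, 'm, 'e) gmod_scheme \<Rightarrow> ('k mpoly, 'n, 'f) gmod_scheme \<Rightarrow>
    ('m \<Rightarrow> 'n) \<Rightarrow> bool" where
  "graded_iso n M N f \<longleftrightarrow> graded_hom n M N f \<and> bij_betw f (carrier M) (carrier N)"

definition graded_isomorphic ::
  "nat \<Rightarrow> ('k::field mpoly, 'm, 'e) gmod_scheme \<Rightarrow> ('k mpoly, 'n, 'f) gmod_scheme \<Rightarrow> bool" where
  "graded_isomorphic n M N \<longleftrightarrow> (\<exists>f. graded_iso n M N f)"

definition sub_gmod :: "('r, 'm, 'e) gmod_scheme \<Rightarrow> 'm set \<Rightarrow> ('r, 'm, 'e) gmod_scheme" where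
  "sub_gmod M A = M\<lparr>carrier := A, deg_part := \<lambda>j. deg_part M j \<inter> A\<rparr>"

text \<open>The quotient by a submodule, with the cosets of homogeneous elements as homogeneous elements.
  The ring multiplication and unit in a module record carry no meaning.\<close>

definition quot_gmod :: "('r, 'm, 'e) gmod_scheme \<Rightarrow> 'm set \<Rightarrow> ('r, 'm set) gmod" where
  "quot_gmod M N =
     \<lparr>carrier = a_rcosets\<^bsub>M\<^esub> N, monoid.mult = (\<lambda>_ _. N), one = N, zero = N,
      add = (\<lambda>A B. A <+>\<^bsub>M\<^esub> B),
      smult = (\<lambda>r A. \<Union>x \<in> A. N +>\<^bsub>M\<^esub> (r \<odot>\<^bsub>M\<^esub> x)),
      deg_part = (\<lambda>j. (\<lambda>x. N +>\<^bsub>M\<^esub> x) ` deg_part M j)\<rparr>"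

text \<open>The map that \<open>f\<close> induces on cosets, with values in the cosets of the submodule \<open>N\<close> of the
  target \<open>M\<close>.\<close>

definition induced_map :: "('r, 'n, 'e) module_scheme \<Rightarrow> 'n set \<Rightarrow> ('m \<Rightarrow> 'n) \<Rightarrow> 'm set \<Rightarrow> 'n set"
  where
  "induced_map M N f A = (\<Union>x \<in> A. N +>\<^bsub>M\<^esub> f x)"

text \<open>A graded module is free if it has a basis of homogeneous elements, i.e. if it is a direct sum
  of twists of \<open>S\<close>.\<close>

definition is_basis :: "nat \<Rightarrow> ('k::field mpoly, 'm, 'e) module_scheme \<Rightarrow> 'm set \<Rightarrow> bool" where
  "is_basis n M B \<longleftrightarrow> B \<subseteq> carrier M \<and>
     (\<forall>x \<in> carrier M. \<exists>!c. (\<forall>b. c b \<in> carrier (Poly_Ring n)) \<and> {b. c b \<noteq> 0} \<subseteq> B \<and>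
        finite {b. c b \<noteq> 0} \<and> x = finsum M (\<lambda>b. c b \<odot>\<^bsub>M\<^esub> b) {b. c b \<noteq> 0})"

definition graded_free :: "nat \<Rightarrow> ('k::field mpoly, 'm, 'e) gmod_scheme \<Rightarrow> bool" where
  "graded_free n M \<longleftrightarrow>
     graded_module n M \<and> (\<exists>B \<subseteq> (\<Union>j. deg_part M j). is_basis n M B)"

definition max_ideal_times :: "nat \<Rightarrow> ('k::field mpoly, 'm, 'e) module_scheme \<Rightarrow> 'm set" where
  "max_ideal_times n M =
     generate (add_monoid M) {r \<odot>\<^bsub>M\<^esub> x | r x. r \<in> max_ideal n \<and> x \<in> carrier M}"

text \<open>\<open>M \<otimes>\<^sub>S k\<close>, formed as \<open>M/\<mm>M\<close> with \<open>\<mm>\<close> the maximal ideal and \<open>k = S/\<mm>\<close>.\<close>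

definition tensor_k :: "nat \<Rightarrow> ('k::field mpoly, 'm, 'e) gmod_scheme \<Rightarrow> ('k mpoly, 'm set) gmod"
  where
  "tensor_k n M = quot_gmod M (max_ideal_times n M)"

definition residue_field :: "('k::field mpoly, 'k) gmod" where
  "residue_field =
     \<lparr>carrier = UNIV, monoid.mult = (*), one = 1, zero = 0, add = (+),
      smult = (\<lambda>p c. const_coeff p * c),
      deg_part = (\<lambda>j. if j = 0 then UNIV else {0})\<rparr>"


section \<open>Differential modules\<close>

record ('r, 'm) dmod = "('r, 'm) gmod" +
  differential :: "'m \<Rightarrow> 'm"

definition diff_module :: "nat \<Rightarrow> int \<Rightarrow> ('k::field mpoly, 'm) dmod \<Rightarrow> bool" where
  "diff_module n a D \<longleftrightarrow>
     graded_module n D \<and> graded_hom n D (twist a D) (differential D) \<and>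
     (\<forall>x \<in> carrier D. differential D (differential D x) = \<zero>\<^bsub>D\<^esub>)"

definition cycles :: "('r, 'm) dmod \<Rightarrow> 'm set" where
  "cycles D = {x \<in> carrier D. differential D x = \<zero>\<^bsub>D\<^esub>}"

definition boundaries :: "('r, 'm) dmod \<Rightarrow> 'm set" where
  "boundaries D = differential D ` carrier D"

definition homology :: "('r, 'm) dmod \<Rightarrow> ('r, 'm set) gmod" where
  "homology D = quot_gmod (sub_gmod D (cycles D)) (boundaries D)"

definition dm_morphism ::
  "nat \<Rightarrow> ('k::field mpoly, 'm) dmod \<Rightarrow> ('k mpoly, 'n) dmod \<Rightarrow> ('m \<Rightarrow> 'n) \<Rightarrow> bool" where
  "dm_morphism n D E f \<longleftrightarrow>
     graded_hom n D E f \<and>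
     (\<forall>x \<in> carrier D. f (differential D x) = differential E (f x))"

definition quasi_iso ::
  "nat \<Rightarrow> ('k::field mpoly, 'm) dmod \<Rightarrow> ('k mpoly, 'n) dmod \<Rightarrow> ('m \<Rightarrow> 'n) \<Rightarrow> bool" where
  "quasi_iso n D E f \<longleftrightarrow>
     dm_morphism n D E f \<and>
     graded_iso n (homology D) (homology E) (induced_map E (boundaries E) f)"

definition split_injection ::
  "nat \<Rightarrow> ('k::field mpoly, 'm) dmod \<Rightarrow> ('k mpoly, 'n) dmod \<Rightarrow> ('m \<Rightarrow> 'n) \<Rightarrow> bool" where
  "split_injection n D E f \<longleftrightarrow>
     dm_morphism n D E f \<and>
     (\<exists>g. dm_morphism n E D g \<and> (\<forall>x \<in> carrier D. g (f x) = x))"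

definition free_diff_module :: "nat \<Rightarrow> int \<Rightarrow> ('k::field mpoly, 'm) dmod \<Rightarrow> bool" where
  "free_diff_module n a M \<longleftrightarrow> diff_module n a M \<and> graded_free n M"

definition minimal :: "nat \<Rightarrow> int \<Rightarrow> ('k::field mpoly, 'm) dmod \<Rightarrow> bool" where
  "minimal n a M \<longleftrightarrow>
     free_diff_module n a M \<and>
     (\<forall>A \<in> carrier (tensor_k n M).
        induced_map M (max_ideal_times n M) (differential M) A = \<zero>\<^bsub>tensor_k n M\<^esub>)"

definition free_flag :: "nat \<Rightarrow> int \<Rightarrow> ('k::field mpoly, 'm) dmod \<Rightarrow> bool" where
  "free_flag n a F \<longleftrightarrow>
     diff_module n a F \<and>
     (\<exists>A :: nat \<Rightarrow> 'm set.
        is_direct_sum F A \<and>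
        (\<forall>i. graded_free n (sub_gmod F (A i))) \<and>
        (\<forall>i. \<forall>x \<in> A i. \<exists>y. (\<forall>j<i. y j \<in> A j) \<and> differential F x = finsum F y {..<i}))"

definition free_flag_resolution ::
  "nat \<Rightarrow> int \<Rightarrow> ('k::field mpoly, 'f) dmod \<Rightarrow> ('k mpoly, 'm) dmod \<Rightarrow> ('f \<Rightarrow> 'm) \<Rightarrow> bool" where
  "free_flag_resolution n a F D \<epsilon> \<longleftrightarrow>
     free_flag n a F \<and> diff_module n a D \<and> quasi_iso n F D \<epsilon>"

text \<open>The first argument is the type of elements of the intermediate free flag, over which HOL
  cannot quantify.\<close>

definition minimal_free_resolution ::
  "'f itself \<Rightarrow> nat \<Rightarrow> int \<Rightarrow> ('k::field mpoly, 'm) dmod \<Rightarrow> ('k mpoly, 'n) dmod \<Rightarrow>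
    ('m \<Rightarrow> 'n) \<Rightarrow> bool" where
  "minimal_free_resolution (_ :: 'f itself) n a M D \<phi> \<longleftrightarrow>
     minimal n a M \<and> quasi_iso n M D \<phi> \<and>
     (\<exists>(F :: ('k mpoly, 'f) dmod) \<iota> \<epsilon>.
        free_flag_resolution n a F D \<epsilon> \<and> split_injection n M F \<iota> \<and>
        (\<forall>x \<in> carrier M. \<phi> x = \<epsilon> (\<iota> x)))"


section \<open>The differential modules \<open>D\<^sub>n\<close>\<close>

text \<open>The direct sum of the twists \<open>S(t)\<close>, for \<open>t\<close> in the list \<open>ts\<close>, of \<open>S = k[x\<^sub>1,\<dots>,x\<^sub>n]\<close>, with
  the differential given by the matrix \<open>A\<close> acting on column vectors.\<close>

definition matrix_dmod ::
  "nat \<Rightarrow> int list \<Rightarrow> 'k::field mpoly mat \<Rightarrow> ('k mpoly, 'k mpoly vec) dmod" where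
  "matrix_dmod n ts A =
     \<lparr>carrier = {v \<in> carrier_vec (length ts). \<forall>i < length ts. v $ i \<in> carrier (Poly_Ring n)},
      monoid.mult = (\<lambda>_ _. 0\<^sub>v (length ts)), one = 0\<^sub>v (length ts),
      zero = 0\<^sub>v (length ts), add = (+), smult = (\<cdot>\<^sub>v),
      deg_part = (\<lambda>j. {v \<in> carrier_vec (length ts).
                        \<forall>i < length ts. v $ i \<in> Poly_deg n (j + ts ! i)}),
      differential = (\<lambda>v. A *\<^sub>v v)\<rparr>"

text \<open>Both recursions start at \<open>n = 2\<close>; the values for \<open>n < 2\<close> are irrelevant. The list of twists
  has the parameter \<open>c\<close> because the grading of the free module of rank 2 underlying \<open>D\<^sub>2\<close> is
  determined only up to a twist: it is \<open>S(c)\<^sup>2\<close>.\<close>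

definition D2_matrix :: "'k::field mpoly mat" where
  "D2_matrix = mat_of_rows_list 2 [[Var 1 * Var 2, - (Var 2)\<^sup>2], [(Var 1)\<^sup>2, - (Var 1 * Var 2)]]"

primrec D_matrix :: "nat \<Rightarrow> 'k::field mpoly mat" where
  "D_matrix 0 = D2_matrix"
| "D_matrix (Suc n) =
     (if n < 2 then D2_matrix
      else let d = D_matrix n; r = dim_row d
           in four_block_mat (- d) (Var (Suc n) \<cdot>\<^sub>m 1\<^sub>m r) (0\<^sub>m r r) d)"

primrec D_twists :: "int \<Rightarrow> nat \<Rightarrow> int list" where
  "D_twists c 0 = [c, c]"
| "D_twists c (Suc n) =
     (if n < 2 then [c, c] else D_twists c n @ map (\<lambda>t. t + 1) (D_twists c n))"

definition Dn :: "int \<Rightarrow> nat \<Rightarrow> ('k::field mpoly, 'k mpoly vec) dmod" where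
  "Dn c n = matrix_dmod n (D_twists c n) (D_matrix n)"

lemma length_D_twists: "n \<ge> 2 \<Longrightarrow> length (D_twists c n) = 2 ^ (n - 1)"
proof (induction n rule: nat_induct_at_least)
  case base
  show ?case by (simp add: numeral_2_eq_2)
next
  case (Suc n)
  then obtain m where "n = Suc m" by (cases n) auto
  with Suc show ?case by simp
qed

lemma dim_D_matrix:
  assumes "n \<ge> 2"
  shows "(D_matrix n :: 'k::field mpoly mat) \<in> carrier_mat (2 ^ (n - 1)) (2 ^ (n - 1))"
  using assms
proof (induction n rule: nat_induct_at_least)
  case base
  show ?case by (simp add: numeral_2_eq_2 D2_matrix_def mat_of_rows_list_def)
next
  case (Suc n)
  then have d: "(D_matrix n :: 'k mpoly mat) \<in> carrier_mat (2 ^ (n - 1)) (2 ^ (n - 1))"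
    by blast
  have e: "(2::nat) ^ (Suc n - 1) = 2 ^ (n - 1) + 2 ^ (n - 1)"
    using \<open>2 \<le> n\<close> by (cases n) auto
  have "\<not> n < 2"
    using \<open>2 \<le> n\<close> by linarith
  then have "D_matrix (Suc n) = (let d = D_matrix n :: 'k mpoly mat; r = dim_row d
      in four_block_mat (- d) (Var (Suc n) \<cdot>\<^sub>m 1\<^sub>m r) (0\<^sub>m r r) d)"
    by simp
  then show ?case
    unfolding e Let_def using d four_block_carrier_mat by (metis uminus_carrier_mat)
qed

end

theory Submission
  imports Defs
begin

text \<open>The module \<open>D\<^sub>n\<close> is minimal because its matrix has entries in the maximal ideal, and it resolves
  itself: it is a direct summand, with contractible complement, of a free flag \<open>F\<^sub>n\<close> of rank \<open>2\<^sup>n\<close>, so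
  that the projection of \<open>F\<^sub>n\<close> onto \<open>D\<^sub>n\<close> is a free flag resolution. For \<open>n = 2\<close> the flag is the Koszul
  complex with a unit added to its differential, and \<open>F\<^sub>n\<close> is the mapping cone of \<open>x\<^sub>n\<close> on \<open>F\<^bsub>n-1\<^esub>\<close>, just
  as \<open>D\<^sub>n\<close> is the mapping cone of \<open>x\<^sub>n\<close> on \<open>D\<^bsub>n-1\<^esub>\<close>. The homology of \<open>D\<^sub>2\<close> is \<open>k\<close>, generated by the class of
  \<open>(x\<^sub>2, x\<^sub>1)\<close>; each cone kills the new variable, which acts injectively on the homology of
  the extension of scalars.\<close>


section \<open>Polynomials\<close>

text \<open>D_2 is not itself a free flag: the lowest nonzero layer of a flag consists of cycles,
  whereas the cycles of D_2 are the multiples of (x_2, x_1), none of which belongs to a basis. Hence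
  the detour through a larger flag, which needs a unit in its differential to have a contractible
  part. Degree 2 makes room for this unit: it joins the Koszul generators of exterior degrees 2 and
  0. The cone step needs the homology of D_n after x_{n+1} has been adjoined. Instead of a flatness
  argument, the computation takes place once and for all in the ring in all variables;
  k[x_1,...,x_n] is recovered at the end by discarding every monomial that involves another
  variable. The twist c - 1 in the result arises because (x_2, x_1) has polynomial degree 1 in S(c),
  hence degree 1 - c.\<close>

lemma Poly_Ring_simps [simp]:
  "monoid.mult (Poly_Ring n) = (*)" "one (Poly_Ring n) = 1" "zero (Poly_Ring n) = 0" "add (Poly_Ring n) = (+)"
  by (simp_all add: Poly_Ring_def)

text \<open>The rings k[x_1,...,x_n], their graded pieces, the maximal ideal and the polynomials
  free of a variable are all described by the monomials that may occur. This one notion turns their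
  closure properties into facts about sets of monomials.\<close>

definition supported :: "'a set \<Rightarrow> ('a \<Rightarrow>\<^sub>0 'b::zero) set" where
  "supported T = {p. Poly_Mapping.keys p \<subseteq> T}"

lemma supported_mono: "p \<in> supported T \<Longrightarrow> T \<subseteq> U \<Longrightarrow> p \<in> supported U"
  by (auto simp: supported_def)

lemma supported_UNIV [simp]: "p \<in> supported UNIV"
  by (simp add: supported_def)

lemma supported_zero [simp]: "0 \<in> supported T"
  by (simp add: supported_def)

lemma supported_add: "p \<in> supported T \<Longrightarrow> q \<in> supported T \<Longrightarrow> p + q \<in> supported T"
  using keys_add[of p q] by (auto simp: supported_def)

lemma supported_uminus: "(p :: 'a \<Rightarrow>\<^sub>0 'b::ab_group_add) \<in> supported T \<Longrightarrow> - p \<in> supported T"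
  by (auto simp: supported_def in_keys_iff)

lemma supported_diff:
  "(p :: 'a \<Rightarrow>\<^sub>0 'b::ab_group_add) \<in> supported T \<Longrightarrow> q \<in> supported T \<Longrightarrow> p - q \<in> supported T"
  by (metis supported_add supported_uminus diff_conv_add_uminus)

lemma supported_sum: "(\<And>i. i \<in> I \<Longrightarrow> f i \<in> supported T) \<Longrightarrow> sum f I \<in> supported T"
  by (induction I rule: infinite_finite_induct) (auto simp: supported_add)

lemma supported_mult:
  assumes "p \<in> supported A" "q \<in> supported B" "\<And>a b. a \<in> A \<Longrightarrow> b \<in> B \<Longrightarrow> a + b \<in> C"
  shows "p * q \<in> supported C"
proof -
  have "Poly_Mapping.keys (p * q) \<subseteq> {a + b | a b. a \<in> Poly_Mapping.keys p \<and> b \<in> Poly_Mapping.keys q}"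
    by (rule keys_mult)
  with assms show ?thesis by (fastforce simp: supported_def)
qed

lemma supported_single [simp]: "Poly_Mapping.single m c \<in> supported T \<longleftrightarrow> c = 0 \<or> m \<in> T"
  by (simp add: supported_def)

lemma lookup_not_supported: "p \<in> supported T \<Longrightarrow> m \<notin> T \<Longrightarrow> Poly_Mapping.lookup p m = 0"
  by (auto simp: supported_def in_keys_iff)

definition restr :: "'a set \<Rightarrow> ('a \<Rightarrow>\<^sub>0 'b::zero) \<Rightarrow> ('a \<Rightarrow>\<^sub>0 'b)" where
  "restr T p = Poly_Mapping.mapp (\<lambda>m c. if m \<in> T then c else 0) p"

lemma lookup_restr: "Poly_Mapping.lookup (restr T p) m = (if m \<in> T then Poly_Mapping.lookup p m else 0)"
  by (auto simp: restr_def lookup_mapp when_def in_keys_iff)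

lemma keys_restr: "Poly_Mapping.keys (restr T p) = Poly_Mapping.keys p \<inter> T"
  by (auto simp: in_keys_iff lookup_restr split: if_splits)

lemma restr_supported [simp]: "restr T p \<in> supported T"
  by (simp add: supported_def keys_restr)

lemma supported_restr: "p \<in> supported U \<Longrightarrow> restr T p \<in> supported U"
  by (auto simp: supported_def keys_restr)

lemma restr_zero [simp]: "restr T 0 = 0"
  by (rule poly_mapping_eqI) (simp add: lookup_restr)

lemma restr_add: "restr T (p + q) = restr T p + restr T q"
  by (rule poly_mapping_eqI) (simp add: lookup_restr lookup_add)

lemma restr_sum: "restr T (sum f I) = (\<Sum>i\<in>I. restr T (f i))"
  by (induction I rule: infinite_finite_induct) (auto simp: restr_add)

lemma restr_ident: "p \<in> supported T \<Longrightarrow> restr T p = p"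
  by (rule poly_mapping_eqI) (auto simp: lookup_restr lookup_not_supported)

lemma restr_eq_0: "p \<in> supported U \<Longrightarrow> U \<inter> T = {} \<Longrightarrow> restr T p = 0"
  by (rule poly_mapping_eqI) (use lookup_not_supported in \<open>fastforce simp: lookup_restr\<close>)

lemma restr_split: "p = restr T p + restr (- T) p"
  by (rule poly_mapping_eqI) (auto simp: lookup_restr lookup_add)

text \<open>Adding an element of \<open>T\<close> maps \<open>T\<close> and its complement into
  themselves, so the part of \<open>q\<close> outside \<open>T\<close> contributes nothing. For
  \<open>T = monoms n\<close> the restriction is thus a k[x_1,...,x_n]-linear retraction of the ring
  in all variables.\<close>

lemma restr_mult:
  assumes "p \<in> supported T" "\<And>a b. a \<in> T \<Longrightarrow> a + b \<in> T \<longleftrightarrow> b \<in> T"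
  shows "restr T (p * q) = p * restr T q"
proof -
  have "p * restr T q \<in> supported T" "p * restr (- T) q \<in> supported (- T)"
    using assms by (auto intro!: supported_mult[OF assms(1) restr_supported])
  then have "restr T (p * restr T q + p * restr (- T) q) = p * restr T q"
    by (simp add: restr_add restr_ident restr_eq_0)
  then show ?thesis by (metis restr_split distrib_left)
qed

lemma lookup_monomial_sum:
  "finite X \<Longrightarrow> Poly_Mapping.lookup (\<Sum>m\<in>X. Poly_Mapping.single m (f m)) k = (if k \<in> X then f k else 0)"
  by (simp add: lookup_sum lookup_single when_def sum.delta)

text \<open>Division by a variable with remainder: the monomials without the variable form the
  remainder, and every other monomial gives up one factor.\<close>

lemma split_off_variable:
  fixes p :: "'k::field mpoly"
  shows "\<exists>r. p = restr {m. Poly_Mapping.lookup m i = 0} p + Var i * r"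
proof -
  let ?X = "{m \<in> Poly_Mapping.keys p. Poly_Mapping.lookup m i \<noteq> 0}"
  let ?e = "Poly_Mapping.single i (1::nat)"
  let ?r = "\<Sum>m\<in>?X. Poly_Mapping.single (m - ?e) (Poly_Mapping.lookup p m)"
  \<comment> \<open>Subtraction of exponents is truncated, so the variable must occur in the
    monomial.\<close>
  have e: "?e + (m - ?e) = m" if "Poly_Mapping.lookup m i \<noteq> 0" for m
    using that by (intro poly_mapping_eqI) (auto simp: lookup_add lookup_minus lookup_single when_def)
  have r: "Var i * ?r = (\<Sum>m\<in>?X. Poly_Mapping.single m (Poly_Mapping.lookup p m))"
    unfolding sum_distrib_left by (rule sum.cong) (simp_all add: Var_def mult_single e del: One_nat_def)
  have "p = restr {m. Poly_Mapping.lookup m i = 0} p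
      + (\<Sum>m\<in>?X. Poly_Mapping.single m (Poly_Mapping.lookup p m))"
    by (rule poly_mapping_eqI) (auto simp: lookup_restr lookup_add lookup_monomial_sum in_keys_iff)
  then show ?thesis unfolding r[symmetric] by (rule exI)
qed

lemma Var_supported: "(Var i :: 'k::field mpoly) \<in> supported T \<longleftrightarrow> Poly_Mapping.single i 1 \<in> T"
  by (simp add: Var_def)

text \<open>Every monomial of a multiple of the variable contains it, so none is left. This serves
  as the coprimality of x_1 and x_2 in rank 2 and, for the cone, as the independence of the class of
  the cycle modulo the new variable.\<close>

lemma Var_mult_supported_imp_0:
  fixes r :: "'k::field mpoly"
  assumes "Var i * r \<in> supported {m. Poly_Mapping.lookup m i = 0}"
  shows "Var i * r = 0"
proof -
  have "Var i * r \<in> supported {m. Poly_Mapping.lookup m i \<noteq> 0}"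
    by (rule supported_mult[where A = "{Poly_Mapping.single i 1}" and B = UNIV])
      (auto simp: Var_supported lookup_add)
  with assms show ?thesis by (fastforce simp: supported_def simp flip: keys_eq_empty)
qed

lemma Var_neq_0 [simp]: "(Var i :: 'k::field mpoly) \<noteq> 0"
  by (metis Var_def keys_single keys_zero insert_not_empty one_neq_zero)

section \<open>The rings k[x_1,...,x_n], their gradings and maximal ideals\<close>

definition monoms :: "nat \<Rightarrow> (nat \<Rightarrow>\<^sub>0 nat) set" where
  "monoms n = {m. Poly_Mapping.keys m \<subseteq> {1..n}}"

text \<open>Variables are indexed by all of \<open>nat\<close>, so these are the monomials in x_0
  and x_{n+1}, x_{n+2}, and so on. The polynomials supported here are the coefficients of homology
  over the ring in all variables.\<close>

definition free_monoms :: "nat \<Rightarrow> (nat \<Rightarrow>\<^sub>0 nat) set" where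
  "free_monoms n = {m. Poly_Mapping.keys m \<inter> {1..n} = {}}"

lemma keys_add_monom: "Poly_Mapping.keys (a + b) = Poly_Mapping.keys a \<union> Poly_Mapping.keys b"
  for a b :: "'a \<Rightarrow>\<^sub>0 nat"
  by (auto simp: in_keys_iff lookup_add)

lemma carrier_Poly_Ring: "carrier (Poly_Ring n) = supported (monoms n)"
  by (auto simp: Poly_Ring_def supported_def monoms_def)

lemma Poly_deg_eq: "Poly_deg n j = supported {m \<in> monoms n. int (monom_degree m) = j}"
  by (auto simp: Poly_deg_def carrier_Poly_Ring supported_def)

lemma max_ideal_eq: "max_ideal n = supported (monoms n - {0})"
  by (auto simp: max_ideal_def const_coeff_def carrier_Poly_Ring supported_def in_keys_iff)

lemma zero_monoms [simp]: "0 \<in> monoms n"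
  by (simp add: monoms_def)

lemma add_monoms: "a + b \<in> monoms n \<longleftrightarrow> a \<in> monoms n \<and> b \<in> monoms n"
  by (auto simp: monoms_def keys_add_monom)

lemma monom_degree_add: "monom_degree (a + b) = monom_degree a + monom_degree b"
proof -
  have eq: "monom_degree m = (\<Sum>i\<in>K. Poly_Mapping.lookup m i)"
    if "finite K" "Poly_Mapping.keys m \<subseteq> K" for m K
    unfolding monom_degree_def using that
    by (intro sum.mono_neutral_left) (auto simp: in_keys_iff)
  let ?K = "Poly_Mapping.keys a \<union> Poly_Mapping.keys b"
  have "monom_degree (a + b) = (\<Sum>i\<in>?K. Poly_Mapping.lookup (a + b) i)"
    by (rule eq) (simp_all add: keys_add_monom)
  also have "\<dots> = (\<Sum>i\<in>?K. Poly_Mapping.lookup a i) + (\<Sum>i\<in>?K. Poly_Mapping.lookup b i)"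
    by (simp add: lookup_add sum.distrib)
  also have "\<dots> = monom_degree a + monom_degree b"
    by (simp only: eq[of ?K a] eq[of ?K b] finite_Un finite_keys Un_upper1 Un_upper2)
  finally show ?thesis .
qed

lemma monom_degree_zero [simp]: "monom_degree 0 = 0"
  by (simp add: monom_degree_def)

lemma monom_degree_single [simp]: "monom_degree (Poly_Mapping.single i e) = e"
  by (simp add: monom_degree_def)

lemma monom_degree_eq_0_iff: "monom_degree m = 0 \<longleftrightarrow> m = 0"
  by (auto simp: monom_degree_def in_keys_iff simp flip: keys_eq_empty)

lemma Poly_Ring_zero: "0 \<in> carrier (Poly_Ring n)"
  and Poly_Ring_one: "1 \<in> carrier (Poly_Ring n)"
  and Poly_Ring_const: "Poly_Mapping.single 0 c \<in> carrier (Poly_Ring n)"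
  and Poly_Ring_add: "p \<in> carrier (Poly_Ring n) \<Longrightarrow> q \<in> carrier (Poly_Ring n) \<Longrightarrow> p + q \<in> carrier (Poly_Ring n)"
  and Poly_Ring_uminus: "p \<in> carrier (Poly_Ring n) \<Longrightarrow> - p \<in> carrier (Poly_Ring n)"
  and Poly_Ring_mult: "p \<in> carrier (Poly_Ring n) \<Longrightarrow> q \<in> carrier (Poly_Ring n) \<Longrightarrow> p * q \<in> carrier (Poly_Ring n)"
  and Poly_Ring_sum: "(\<And>i. i \<in> I \<Longrightarrow> f i \<in> carrier (Poly_Ring n)) \<Longrightarrow> sum f I \<in> carrier (Poly_Ring n)"
  by (auto simp: carrier_Poly_Ring add_monoms supported_add supported_uminus supported_sum
      simp flip: single_one intro: supported_mult)

lemma cring_Poly_Ring: "cring (Poly_Ring n :: 'k::field mpoly ring)"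
proof (intro cringI abelian_groupI comm_monoidI)
  fix x :: "'k mpoly" assume "x \<in> carrier (Poly_Ring n)"
  then show "\<exists>y\<in>carrier (Poly_Ring n). y \<oplus>\<^bsub>Poly_Ring n\<^esub> x = \<zero>\<^bsub>Poly_Ring n\<^esub>"
    by (intro bexI[of _ "- x"]) (auto intro: Poly_Ring_uminus)
qed (auto simp: algebra_simps Poly_Ring_zero Poly_Ring_one intro: Poly_Ring_add Poly_Ring_mult)

lemma Poly_deg_carrier: "p \<in> Poly_deg n j \<Longrightarrow> p \<in> carrier (Poly_Ring n)"
  by (simp add: Poly_deg_def)

lemma Poly_deg_zero [simp]: "0 \<in> Poly_deg n j"
  and Poly_deg_one: "1 \<in> Poly_deg n 0"
  and Poly_deg_Var: "1 \<le> i \<Longrightarrow> i \<le> n \<Longrightarrow> Var i \<in> Poly_deg n 1"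
  and Poly_deg_uminus: "p \<in> Poly_deg n j \<Longrightarrow> - p \<in> Poly_deg n j"
  and Poly_deg_sum: "(\<And>i. i \<in> I \<Longrightarrow> f i \<in> Poly_deg n j) \<Longrightarrow> sum f I \<in> Poly_deg n j"
  by (auto simp: Poly_deg_eq supported_add supported_uminus supported_sum Var_supported monoms_def
      simp flip: single_one)

lemma Poly_deg_mult: "p \<in> Poly_deg n i \<Longrightarrow> q \<in> Poly_deg n j \<Longrightarrow> p * q \<in> Poly_deg n (i + j)"
  unfolding Poly_deg_eq by (erule supported_mult) (auto simp: add_monoms monom_degree_add)

lemma Poly_deg_mono: "p \<in> Poly_deg n j \<Longrightarrow> n \<le> m \<Longrightarrow> p \<in> Poly_deg m j"
  unfolding Poly_deg_eq by (erule supported_mono) (auto simp: monoms_def)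

lemma max_ideal_Poly_deg: "p \<in> Poly_deg n j \<Longrightarrow> j \<noteq> 0 \<Longrightarrow> p \<in> max_ideal n"
  unfolding Poly_deg_eq max_ideal_eq by (erule supported_mono) auto

lemma max_ideal_sum: "(\<And>i. i \<in> I \<Longrightarrow> f i \<in> max_ideal n) \<Longrightarrow> sum f I \<in> max_ideal n"
  by (auto simp: max_ideal_eq supported_add supported_sum)

lemma max_ideal_mult: "p \<in> max_ideal n \<Longrightarrow> q \<in> carrier (Poly_Ring n) \<Longrightarrow> p * q \<in> max_ideal n"
  unfolding max_ideal_eq carrier_Poly_Ring
  by (erule supported_mult) (auto simp: add_monoms dest: arg_cong[of _ _ monom_degree] simp: monom_degree_add monom_degree_eq_0_iff)

lemma const_coeff_add: "const_coeff (p + q) = const_coeff p + const_coeff q"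
  by (simp add: const_coeff_def lookup_add)

lemma const_coeff_single [simp]: "const_coeff (Poly_Mapping.single 0 c) = c"
  by (simp add: const_coeff_def)

text \<open>The polynomials without constant term absorb products, so modulo them both factors may
  be replaced by their constant terms.\<close>

lemma const_coeff_mult: "const_coeff (p * q) = const_coeff p * const_coeff q"
proof -
  have c: "const_coeff (p * q) = 0" if "p \<in> supported (- {0})" for p q :: "'a mpoly"
    unfolding const_coeff_def
    by (rule lookup_not_supported[OF supported_mult[where C = "- {0}", OF that supported_UNIV]])
      (auto dest: arg_cong[of _ _ monom_degree] simp: monom_degree_add monom_degree_eq_0_iff)
  have s: "p = Poly_Mapping.single 0 (const_coeff p) + restr (- {0}) p" for p :: "'a mpoly"
    by (rule poly_mapping_eqI) (auto simp: lookup_restr lookup_add lookup_single const_coeff_def when_def)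
  let ?p = "Poly_Mapping.single 0 (const_coeff p)" and ?q = "Poly_Mapping.single 0 (const_coeff q)"
  have "p * q = (?p + restr (- {0}) p) * q"
    using s[of p] by simp
  also have "\<dots> = ?p * (?q + restr (- {0}) q) + restr (- {0}) p * q"
    using s[of q] by (simp add: distrib_right)
  also have "\<dots> = ?p * ?q + restr (- {0}) q * ?p + restr (- {0}) p * q"
    by (simp add: distrib_left mult.commute)
  finally have "p * q = ?p * ?q + restr (- {0}) q * ?p + restr (- {0}) p * q" .
  then have "const_coeff (p * q) = const_coeff (?p * ?q)"
    by (simp only: const_coeff_add c[OF restr_supported]) simp
  then show ?thesis by (simp add: mult_single)
qed


section \<open>Homology of differential modules\<close>

lemma sub_gmod_simps [simp]:
  "carrier (sub_gmod M A) = A" "add (sub_gmod M A) = add M" "zero (sub_gmod M A) = zero M"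
  "smult (sub_gmod M A) = smult M" "deg_part (sub_gmod M A) j = deg_part M j \<inter> A"
  by (simp_all add: sub_gmod_def)

lemma twist_simps [simp]:
  "carrier (twist a M) = carrier M" "add (twist a M) = add M" "zero (twist a M) = zero M"
  "smult (twist a M) = smult M" "deg_part (twist a M) j = deg_part M (j + a)"
  by (simp_all add: twist_def)

lemma a_r_coset_sub_gmod [simp]: "I +>\<^bsub>sub_gmod M A\<^esub> x = I +>\<^bsub>M\<^esub> x"
  by (simp add: a_r_coset_def')

text \<open>The induced map is a union over all representatives h + x. All cosets in the union agree
  because f (h + x) = f h + f x with f h in \<open>J\<close>, and the union is not empty because
  \<open>I\<close> contains zero.\<close>

lemma induced_map_coset:
  assumes "module R D" "submodule I R D" "module R E" "submodule J R E"
    and add: "\<And>x y. x \<in> carrier D \<Longrightarrow> y \<in> carrier D \<Longrightarrow> f (x \<oplus>\<^bsub>D\<^esub> y) = f x \<oplus>\<^bsub>E\<^esub> f y"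
    and f: "f \<in> carrier D \<rightarrow> carrier E" and IJ: "f ` I \<subseteq> J" and x: "x \<in> carrier D"
  shows "induced_map E J f (I +>\<^bsub>D\<^esub> x) = J +>\<^bsub>E\<^esub> f x"
proof -
  interpret D: module R D by fact
  interpret I: submodule I R D by fact
  interpret E: module R E by fact
  interpret J: submodule J R E by fact
  have "J +>\<^bsub>E\<^esub> f (h \<oplus>\<^bsub>D\<^esub> x) = J +>\<^bsub>E\<^esub> f x" if h: "h \<in> I" for h
  proof -
    have hD: "h \<in> carrier D" using I.subset h by auto
    have "f (h \<oplus>\<^bsub>D\<^esub> x) = f h \<oplus>\<^bsub>E\<^esub> f x" using add hD x by simp
    moreover have "f h \<oplus>\<^bsub>E\<^esub> f x \<in> J +>\<^bsub>E\<^esub> f x"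
      using IJ h by (auto simp: a_r_coset_def')
    ultimately show ?thesis
      using E.a_repr_independence[of "f (h \<oplus>\<^bsub>D\<^esub> x)" J "f x"] f x J.subgroup_axioms by auto
  qed
  moreover have "I \<noteq> {}" using I.subgroup_axioms I.one_closed by auto
  ultimately show ?thesis
    unfolding induced_map_def a_r_coset_def'[of D] by auto
qed

locale differential_module =
  fixes n :: nat and a :: int and D :: "('k::field mpoly, 'm) dmod" (structure)
  assumes diff_module: "diff_module n a D"
begin

lemma module: "module (Poly_Ring n) D"
  using diff_module by (simp add: diff_module_def graded_module_def)

sublocale module "Poly_Ring n" D
  by (rule module)

abbreviation d where "d \<equiv> differential D"

lemma d_closed [simp]: "x \<in> carrier D \<Longrightarrow> d x \<in> carrier D"
  and d_add: "x \<in> carrier D \<Longrightarrow> y \<in> carrier D \<Longrightarrow> d (x \<oplus> y) = d x \<oplus> d y"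
  and d_smult: "r \<in> carrier (Poly_Ring n) \<Longrightarrow> x \<in> carrier D \<Longrightarrow> d (r \<odot> x) = r \<odot> d x"
  and d_d [simp]: "x \<in> carrier D \<Longrightarrow> d (d x) = \<zero>"
  using diff_module by (auto simp: diff_module_def graded_hom_def linear_map_def)

lemma d_zero [simp]: "d \<zero> = \<zero>"
  using d_add[of \<zero> \<zero>] by (metis d_closed add.l_cancel_one l_zero zero_closed)

lemma d_minus: "x \<in> carrier D \<Longrightarrow> d (\<ominus> x) = \<ominus> d x"
  by (metis add.inv_closed d_add d_closed d_zero l_neg minus_equality)

lemma submodule_cycles: "submodule (cycles D) (Poly_Ring n) D"
  by (rule submoduleI) (auto simp: cycles_def d_add d_smult d_minus)

lemma submodule_boundaries: "submodule (boundaries D) (Poly_Ring n) D"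
proof (rule submoduleI)
  show "\<zero> \<in> boundaries D" unfolding boundaries_def by (rule image_eqI[of _ _ \<zero>]) auto
next
  fix x assume "x \<in> boundaries D"
  then show "\<ominus> x \<in> boundaries D"
    unfolding boundaries_def by (auto simp flip: d_minus)
next
  fix x y assume "x \<in> boundaries D" "y \<in> boundaries D"
  then show "x \<oplus> y \<in> boundaries D"
    unfolding boundaries_def by (auto simp flip: d_add)
next
  fix r :: "'k mpoly" and x assume "r \<in> carrier (Poly_Ring n)" "x \<in> boundaries D"
  then show "r \<odot> x \<in> boundaries D"
    unfolding boundaries_def by (auto simp flip: d_smult)
qed (auto simp: boundaries_def)

sublocale cycles: submodule "cycles D" "Poly_Ring n" D
  by (rule submodule_cycles)

sublocale bds: submodule "boundaries D" "Poly_Ring n" D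
  by (rule submodule_boundaries)

sublocale bds: abelian_subgroup "boundaries D" D
  by (rule abelian_subgroupI3) (auto intro: additive_subgroupI bds.subgroup_axioms module.axioms(2)[OF module])

abbreviation cls where "cls x \<equiv> boundaries D +> x"

lemma cycles_carrier: "x \<in> cycles D \<Longrightarrow> x \<in> carrier D"
  by (simp add: cycles_def)

lemma cls_eq_iff:
  assumes "x \<in> carrier D" "y \<in> carrier D"
  shows "cls x = cls y \<longleftrightarrow> (\<exists>b \<in> boundaries D. x = b \<oplus> y)"
proof -
  have "cls x = cls y \<longleftrightarrow> x \<in> cls y"
    using assms bds.a_rcos_self a_repr_independence[OF _ _ bds.subgroup_axioms, of x y] by metis
  then show ?thesis by (auto simp: a_r_coset_def')
qed

lemma carrier_homology: "carrier (homology D) = cls ` cycles D"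
  by (auto simp: homology_def quot_gmod_def A_RCOSETS_def')

lemma deg_part_homology: "deg_part (homology D) j = cls ` (deg_part D j \<inter> cycles D)"
  by (simp add: homology_def quot_gmod_def)

lemma add_homology:
  assumes "x \<in> carrier D" "y \<in> carrier D"
  shows "cls x \<oplus>\<^bsub>homology D\<^esub> cls y = cls (x \<oplus> y)"
  using bds.a_rcos_sum[OF assms] by (simp add: homology_def quot_gmod_def set_add_def')

lemma smult_homology:
  assumes r: "r \<in> carrier (Poly_Ring n)" and x: "x \<in> carrier D"
  shows "r \<odot>\<^bsub>homology D\<^esub> cls x = cls (r \<odot> x)"
proof -
  \<comment> \<open>The scalar action on cosets is the map induced by multiplication with
    \<open>r\<close>.\<close>
  have "induced_map D (boundaries D) (\<lambda>x. r \<odot> x) (cls x) = cls (r \<odot> x)"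
    by (rule induced_map_coset[OF module submodule_boundaries module submodule_boundaries])
      (use r x in \<open>auto simp: smult_r_distr\<close>)
  then show ?thesis
    by (simp add: homology_def quot_gmod_def induced_map_def)
qed

end

section \<open>Morphisms and quasi-isomorphisms\<close>

lemma dm_morphismD:
  assumes "dm_morphism n D E f"
  shows "x \<in> carrier D \<Longrightarrow> f x \<in> carrier E"
    and "x \<in> carrier D \<Longrightarrow> y \<in> carrier D \<Longrightarrow> f (x \<oplus>\<^bsub>D\<^esub> y) = f x \<oplus>\<^bsub>E\<^esub> f y"
    and "r \<in> carrier (Poly_Ring n) \<Longrightarrow> x \<in> carrier D \<Longrightarrow> f (r \<odot>\<^bsub>D\<^esub> x) = r \<odot>\<^bsub>E\<^esub> f x"
    and "x \<in> carrier D \<Longrightarrow> f (differential D x) = differential E (f x)"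
    and "x \<in> deg_part D j \<Longrightarrow> f x \<in> deg_part E j"
  using assms by (auto simp: dm_morphism_def graded_hom_def linear_map_def)

lemma dm_morphism_zero:
  assumes "diff_module n a D" "diff_module n a E" "dm_morphism n D E f"
  shows "f \<zero>\<^bsub>D\<^esub> = \<zero>\<^bsub>E\<^esub>"
proof -
  interpret D: differential_module n a D by unfold_locales fact
  interpret E: differential_module n a E by unfold_locales fact
  show ?thesis
    using dm_morphismD(1,2)[OF assms(3)]
    by (metis D.zero_closed D.l_zero E.add.l_cancel_one)
qed

text \<open>On a cycle the term s (d x) is s 0 = 0, so x differs from p (q x) by the boundary d (s
  x). Hence \<open>p\<close> and \<open>q\<close> induce inverse maps on homology; the other
  composite is already the identity before passing to homology.\<close>

lemma quasi_iso_homotopy_equivalence: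
  assumes F: "diff_module n a F" and D: "diff_module n a D"
    and q: "dm_morphism n F D q" and p: "dm_morphism n D F p"
    and qp: "\<And>x. x \<in> carrier D \<Longrightarrow> q (p x) = x"
    and s: "\<And>x. x \<in> carrier F \<Longrightarrow> s x \<in> carrier F" "s \<zero>\<^bsub>F\<^esub> = \<zero>\<^bsub>F\<^esub>"
    and homotopy: "\<And>x. x \<in> carrier F \<Longrightarrow>
      x = differential F (s x) \<oplus>\<^bsub>F\<^esub> s (differential F x) \<oplus>\<^bsub>F\<^esub> p (q x)"
  shows "quasi_iso n F D q"
proof -
  interpret F: differential_module n a F by unfold_locales fact
  interpret D: differential_module n a D by unfold_locales fact
  note q_simps = dm_morphismD[OF q] note p_simps = dm_morphismD[OF p]
  have q0: "q \<zero>\<^bsub>F\<^esub> = \<zero>\<^bsub>D\<^esub>" and p0: "p \<zero>\<^bsub>D\<^esub> = \<zero>\<^bsub>F\<^esub>"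
    using dm_morphism_zero F D q p by blast+
  have q_cyc: "q x \<in> cycles D" if "x \<in> cycles F" for x
    using that by (auto simp: cycles_def q_simps(1) q0 simp flip: q_simps(4))
  have p_cyc: "p x \<in> cycles F" if "x \<in> cycles D" for x
    using that by (auto simp: cycles_def p_simps(1) p0 simp flip: p_simps(4))
  have q_bd: "q ` boundaries F \<subseteq> boundaries D" and p_bd: "p ` boundaries D \<subseteq> boundaries F"
    by (auto simp: boundaries_def p_simps q_simps)
  let ?f = "induced_map D (boundaries D) q" and ?g = "induced_map F (boundaries F) p"
  have f: "?f (F.cls x) = D.cls (q x)" if "x \<in> carrier F" for x
    using that q_bd by (intro induced_map_coset[OF F.module F.submodule_boundaries D.module D.submodule_boundaries])
      (auto simp: q_simps)
  have g: "?g (D.cls x) = F.cls (p x)" if "x \<in> carrier D" for x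
    using that p_bd by (intro induced_map_coset[OF D.module D.submodule_boundaries F.module F.submodule_boundaries])
      (auto simp: p_simps)
  have pq: "F.cls (p (q x)) = F.cls x" if x: "x \<in> cycles F" for x
  proof -
    have xF: "x \<in> carrier F" using x by (simp add: cycles_def)
    have "x = differential F (s x) \<oplus>\<^bsub>F\<^esub> p (q x)"
      using homotopy[OF xF] x s xF by (simp add: cycles_def p_simps q_simps)
    moreover have "differential F (s x) \<in> boundaries F"
      using s xF by (auto simp: boundaries_def)
    ultimately show ?thesis
      using F.cls_eq_iff[of x "p (q x)"] xF p_simps(1) q_simps(1) by metis
  qed
  have "bij_betw ?f (carrier (homology F)) (carrier (homology D))"
    by (rule bij_betw_byWitness[where f' = ?g])
      (auto simp: F.carrier_homology D.carrier_homology f g F.cycles_carrier D.cycles_carrier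
        p_simps q_simps qp pq q_cyc p_cyc)
  moreover have "graded_hom n (homology F) (homology D) ?f"
    unfolding graded_hom_def linear_map_def
    by (auto simp: F.carrier_homology D.carrier_homology F.deg_part_homology D.deg_part_homology
        F.add_homology D.add_homology F.smult_homology D.smult_homology f
        F.cycles_carrier D.cycles_carrier q_simps q_cyc)
  ultimately show ?thesis
    using q by (simp add: quasi_iso_def graded_iso_def)
qed

lemma dm_morphism_id: "dm_morphism n D D (\<lambda>x. x)"
  by (simp add: dm_morphism_def graded_hom_def linear_map_def)

lemma quasi_iso_id:
  assumes "diff_module n a D"
  shows "quasi_iso n D D (\<lambda>x. x)"
proof -
  interpret differential_module n a D by unfold_locales fact
  show ?thesis
    by (rule quasi_iso_homotopy_equivalence[OF assms assms dm_morphism_id dm_morphism_id,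
          where s = "\<lambda>_. \<zero>\<^bsub>D\<^esub>"]) simp_all
qed

text \<open>The functional \<open>l\<close> reads off the coefficient of the class of \<open>z\<close>.\<close>

lemma (in differential_module) homology_residue_field:
  assumes z: "z \<in> cycles D" "z \<in> deg_part D (- t)"
    and span: "\<And>x. x \<in> cycles D \<Longrightarrow> \<exists>c. \<exists>b \<in> boundaries D. x = b \<oplus> Poly_Mapping.single 0 c \<odot> z"
    and l_add: "\<And>x y. x \<in> carrier D \<Longrightarrow> y \<in> carrier D \<Longrightarrow> l (x \<oplus> y) = l x + (l y :: 'k)"
    and l_bd: "\<And>b. b \<in> boundaries D \<Longrightarrow> l b = 0"
    and l_z: "\<And>r. r \<in> carrier (Poly_Ring n) \<Longrightarrow> l (r \<odot> z) = const_coeff r"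
    and l_deg: "\<And>j x. x \<in> deg_part D j \<Longrightarrow> j \<noteq> - t \<Longrightarrow> l x = 0"
  shows "graded_isomorphic n (homology D) (twist t residue_field)"
proof -
  have zD: "z \<in> carrier D" using z(1) by (rule cycles_carrier)
  have l_coset: "l y = l x" if "x \<in> carrier D" "y \<in> cls x" for x y
    using that by (auto simp: a_r_coset_def' l_add l_bd)
  \<comment> \<open>\<open>l\<close> is constant on each homology class, so any representative will
    do.\<close>
  define f where "f A = l (SOME y. y \<in> A)" for A
  have f: "f (cls x) = l x" if "x \<in> carrier D" for x
    unfolding f_def using that bds.a_rcos_self[OF that] by (intro l_coset) (auto intro: someI)
  \<comment> \<open>The hypotheses make \<open>l\<close> additive only. On a cycle b + c z linearity
    follows: r b is again a boundary, and \<open>l\<close> is known on the multiples of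
    \<open>z\<close>.\<close>
  have l_smult: "l (r \<odot> x) = const_coeff r * l x"
    if r: "r \<in> carrier (Poly_Ring n)" and x: "x \<in> cycles D" for r x
  proof -
    obtain c b where b: "b \<in> boundaries D" and xe: "x = b \<oplus> Poly_Mapping.single 0 c \<odot> z"
      using span[OF x] by blast
    have bD: "b \<in> carrier D" using bds.subset b by auto
    let ?c = "Poly_Mapping.single 0 c :: 'k mpoly"
    have "r \<odot> x = r \<odot> b \<oplus> (r * ?c) \<odot> z"
      using r bD zD Poly_Ring_const[of c n] smult_assoc1[of r ?c z]
      by (simp add: xe smult_r_distr)
    moreover have "l x = c"
      using bD zD Poly_Ring_const[of c n] by (simp add: xe l_add l_bd b l_z)
    moreover have "r * ?c \<in> carrier (Poly_Ring n)"
      using r by (intro Poly_Ring_mult Poly_Ring_const)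
    ultimately show ?thesis
      using r bD zD b by (simp add: l_add l_bd l_z const_coeff_mult)
  qed
  have inj: "cls x = cls y" if x: "x \<in> cycles D" and y: "y \<in> cycles D" and e: "l x = l y" for x y
  proof -
    have *: "\<exists>b\<in>boundaries D. x = b \<oplus> Poly_Mapping.single 0 (l x) \<odot> z" if x: "x \<in> cycles D" for x
    proof -
      obtain c b where b: "b \<in> boundaries D" and xe: "x = b \<oplus> Poly_Mapping.single 0 c \<odot> z"
        using span[OF x] by blast
      have bD: "b \<in> carrier D" using bds.subset b by auto
      have "l x = c"
        using bD zD Poly_Ring_const[of c n] by (simp add: xe l_add l_bd b l_z)
      with b xe show ?thesis by auto
    qed
    \<comment> \<open>Both cycles are homologous to the same constant multiple of
      \<open>z\<close>.\<close>
    let ?z = "Poly_Mapping.single 0 (l x) \<odot> z"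
    have "?z \<in> carrier D" using zD Poly_Ring_const by blast
    then show ?thesis
      using *[OF x] *[OF y] cls_eq_iff[of _ ?z] cycles_carrier x y e by metis
  qed
  have "bij_betw f (carrier (homology D)) UNIV"
    unfolding bij_betw_def
  proof
    show "inj_on f (carrier (homology D))"
      by (auto simp: carrier_homology inj_on_def f cycles_carrier dest: inj)
    have "c \<in> f ` carrier (homology D)" for c
    proof (rule image_eqI)
      let ?c = "Poly_Mapping.single 0 c :: 'k mpoly"
      show "cls (?c \<odot> z) \<in> carrier (homology D)"
        using z(1) Poly_Ring_const by (auto simp: carrier_homology)
      show "c = f (cls (?c \<odot> z))"
        using zD Poly_Ring_const[of c n] by (simp add: f l_z)
    qed
    then show "f ` carrier (homology D) = UNIV" by auto
  qed
  moreover have "graded_hom n (homology D) (twist t residue_field) f"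
    unfolding graded_hom_def linear_map_def
    using l_deg by (auto simp: residue_field_def carrier_homology deg_part_homology add_homology
        smult_homology f cycles_carrier l_add l_smult) 
  ultimately show ?thesis
    unfolding graded_isomorphic_def graded_iso_def by (auto simp: residue_field_def)
qed


section \<open>Free modules of column vectors\<close>

text \<open>Prescribing supports coordinate by coordinate covers the whole module, its graded pieces
  and the layers of a flag at once.\<close>

definition vec_supp :: "nat \<Rightarrow> (nat \<Rightarrow> 'a set) \<Rightarrow> ('a \<Rightarrow>\<^sub>0 'b::zero) vec set" where
  "vec_supp N T = {v \<in> carrier_vec N. \<forall>i<N. v $ i \<in> supported (T i)}"

lemma vec_suppI: "v \<in> carrier_vec N \<Longrightarrow> (\<And>i. i < N \<Longrightarrow> v $ i \<in> supported (T i)) \<Longrightarrow> v \<in> vec_supp N T"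
  by (simp add: vec_supp_def)

lemma vec_suppD:
  "v \<in> vec_supp N T \<Longrightarrow> dim_vec v = N"
  "v \<in> vec_supp N T \<Longrightarrow> v \<in> carrier_vec N"
  "v \<in> vec_supp N T \<Longrightarrow> i < N \<Longrightarrow> v $ i \<in> supported (T i)"
  by (auto simp: vec_supp_def)

lemma vec_supp_mono: "v \<in> vec_supp N U \<Longrightarrow> (\<And>i. i < N \<Longrightarrow> U i \<subseteq> T i) \<Longrightarrow> v \<in> vec_supp N T"
  by (auto simp: vec_supp_def intro: supported_mono)

lemma vec_supp_Int: "vec_supp N T \<inter> vec_supp N U = vec_supp N (\<lambda>i. T i \<inter> U i)"
  by (auto simp: vec_supp_def supported_def)

lemma vec_supp_cong: "(\<And>i. i < N \<Longrightarrow> T i = U i) \<Longrightarrow> vec_supp N T = vec_supp N U"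
  by (auto simp: vec_supp_def)

text \<open>A direct sum of the twists \<open>S(t)\<close>, with \<open>t\<close> the entries of \<open>ts\<close> at the positions in \<open>J\<close>; the
  coordinates at the other positions vanish.\<close>

locale coordinate_module =
  fixes n :: nat and ts :: "int list" and J :: "nat set"
    and M :: "('k::field mpoly, 'k mpoly vec, 'e) gmod_scheme" (structure)
    and T :: "nat \<Rightarrow> (nat \<Rightarrow>\<^sub>0 nat) set" and N :: nat
  defines "T \<equiv> \<lambda>i. if i \<in> J then monoms n else {}" and "N \<equiv> length ts"
  assumes carrier: "carrier M = vec_supp N T"
    and add [simp]: "add M = (+)" and zero [simp]: "\<zero> = 0\<^sub>v N" and smult [simp]: "smult M = (\<cdot>\<^sub>v)"
    and deg_part: "deg_part M j = vec_supp N (\<lambda>i. {m \<in> T i. int (monom_degree m) = j + ts ! i})"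
begin

lemma smult_supported: "p \<in> carrier (Poly_Ring n) \<Longrightarrow> q \<in> supported (T i) \<Longrightarrow> p * q \<in> supported (T i)"
  unfolding carrier_Poly_Ring by (erule supported_mult, assumption) (auto simp: T_def add_monoms split: if_splits)

lemma module: "module (Poly_Ring n) M"
proof (intro moduleI cring_Poly_Ring abelian_groupI)
  fix x assume x: "x \<in> carrier M"
  show "\<exists>y\<in>carrier M. y \<oplus> x = \<zero>"
    using x by (intro bexI[of _ "- x"]) (auto simp: carrier vec_supp_def supported_uminus)
qed (auto simp: carrier vec_supp_def supported_add smult_supported smult_add_distrib_vec
    add_smult_distrib_vec smult_smult_assoc)

sublocale module "Poly_Ring n" M
  by (rule module)

lemma finsum_index:
  assumes "finite X" "f \<in> X \<rightarrow> carrier M"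
  shows "finsum M f X \<in> carrier_vec N \<and> (\<forall>i<N. finsum M f X $ i = (\<Sum>x\<in>X. f x $ i))"
  using assms
proof (induction X rule: finite_induct)
  case (insert x X)
  then have fx: "f x \<in> carrier_vec N" by (auto simp: carrier vec_supp_def)
  have "finsum M f (insert x X) = f x + finsum M f X"
    using insert.prems insert.hyps by (subst finsum_insert) auto
  then show ?case using insert fx by auto
qed simp

lemma subgroup_vec_supp:
  assumes "\<And>i. i < N \<Longrightarrow> U i \<subseteq> T i"
  shows "subgroup (vec_supp N U) (add_monoid M)"
proof (rule subgroup.intro)
  show "inv\<^bsub>add_monoid M\<^esub> x \<in> vec_supp N U" if x: "x \<in> vec_supp N U" for x
  proof -
    have "x \<in> carrier M" using vec_supp_mono[OF x assms] carrier by simp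
    moreover have "- x \<in> vec_supp N U" using x by (auto simp: vec_supp_def supported_uminus)
    moreover from this have "- x \<in> carrier M" using vec_supp_mono[OF _ assms] carrier by simp
    moreover have "- x + x = 0\<^sub>v N" using x by (auto simp: vec_supp_def)
    ultimately show ?thesis
      using minus_equality[of "- x" x] by (simp add: a_inv_def)
  qed
qed (use assms in \<open>auto simp: carrier vec_supp_def supported_add intro: supported_mono\<close>)

text \<open>The pairs of a coordinate and an admissible monomial form a basis over k, and colouring
  a basis splits the space. With the degree as colour this gives the grading, with the coordinate as
  colour the layers of a flag.\<close>

lemma direct_sum_by_colour:
  fixes \<chi> :: "nat \<Rightarrow> (nat \<Rightarrow>\<^sub>0 nat) \<Rightarrow> 't"
  shows "is_direct_sum M (\<lambda>t. vec_supp N (\<lambda>i. {m \<in> T i. \<chi> i m = t}))"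
  unfolding is_direct_sum_def
proof (intro conjI allI ballI)
  let ?A = "\<lambda>t. vec_supp N (\<lambda>i. {m \<in> T i. \<chi> i m = t})"
  show "subgroup (?A t) (add_monoid M)" for t
    by (rule subgroup_vec_supp) auto
  fix x assume x: "x \<in> carrier M"
  have xT: "x $ i \<in> supported (T i)" if "i < N" for i
    using x that by (auto simp: carrier vec_supp_def)
  have xN: "x \<in> carrier_vec N"
    using x by (auto simp: carrier vec_supp_def)
  define g where "g t = vec N (\<lambda>i. restr {m. \<chi> i m = t} (x $ i))" for t
  have gA: "g t \<in> ?A t" for t
  proof (rule vec_suppI)
    fix i assume i: "i < N"
    have "restr {m. \<chi> i m = t} (x $ i) \<in> supported (T i)" using xT[OF i] by (rule supported_restr)
    then show "g t $ i \<in> supported {m \<in> T i. \<chi> i m = t}"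
      using i by (auto simp: g_def supported_def keys_restr)
  qed (simp add: g_def)
  have AM: "?A t \<subseteq> carrier M" for t
    using vec_supp_mono by (auto simp: carrier)
  let ?S = "\<lambda>f. {t. f t \<noteq> \<zero>}"
  show "\<exists>!f. (\<forall>t. f t \<in> ?A t) \<and> finite (?S f) \<and> x = finsum M f (?S f)"
  proof (rule ex1I[of _ g], intro conjI allI gA)
    \<comment> \<open>Only the colours of the finitely many monomials of \<open>x\<close> give a
      nonzero component.\<close>
    have "g t = 0\<^sub>v N" if "t \<notin> (\<Union>i<N. \<chi> i ` Poly_Mapping.keys (x $ i))" for t
    proof (rule eq_vecI)
      fix i assume "i < dim_vec (0\<^sub>v N :: 'k mpoly vec)"
      moreover have "restr {m. \<chi> i m = t} (x $ i) = 0" if "i < N"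
        using that \<open>t \<notin> _\<close> by (auto simp: keys_restr simp flip: keys_eq_empty)
      ultimately show "g t $ i = 0\<^sub>v N $ i" by (simp add: g_def)
    qed (simp add: g_def)
    then have "?S g \<subseteq> (\<Union>i<N. \<chi> i ` Poly_Mapping.keys (x $ i))" by auto
    then show fin: "finite (?S g)" by (rule finite_subset) simp
    have gM: "g \<in> ?S g \<rightarrow> carrier M" using gA AM by blast
    show "x = finsum M g (?S g)"
    proof (rule eq_vecI)
      fix i assume "i < dim_vec (finsum M g (?S g))"
      then have i: "i < N" using finsum_index[OF fin gM] by auto
      have "x $ i = (\<Sum>t\<in>?S g. g t $ i)"
      proof (rule poly_mapping_eqI)
        fix m
        have "Poly_Mapping.lookup (\<Sum>t\<in>?S g. g t $ i) m
            = (\<Sum>t\<in>?S g. if t = \<chi> i m then Poly_Mapping.lookup (x $ i) m else 0)"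
          using i by (auto simp: lookup_sum g_def lookup_restr intro!: sum.cong)
        also have "\<dots> = (if \<chi> i m \<in> ?S g then Poly_Mapping.lookup (x $ i) m else 0)"
          by (rule sum.delta[OF fin])
        also have "\<dots> = Poly_Mapping.lookup (x $ i) m"
        proof (cases "\<chi> i m \<in> ?S g")
          case False
          then have "g (\<chi> i m) = 0\<^sub>v N" by simp
          then have "g (\<chi> i m) $ i = 0" using i by simp
          then have "Poly_Mapping.lookup (restr {m'. \<chi> i m' = \<chi> i m} (x $ i)) m = 0"
            using i by (simp add: g_def)
          then show ?thesis using False by (simp add: lookup_restr)
        qed simp
        finally show "Poly_Mapping.lookup (x $ i) m = Poly_Mapping.lookup (\<Sum>t\<in>?S g. g t $ i) m"
          by simp
      qed
      then show "x $ i = finsum M g (?S g) $ i"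
        using finsum_index[OF fin gM] i by simp
    qed (use finsum_index[OF fin gM] xN in auto)
  next
    fix f assume f: "(\<forall>t. f t \<in> ?A t) \<and> finite (?S f) \<and> x = finsum M f (?S f)"
    then have fM: "f \<in> ?S f \<rightarrow> carrier M" using AM by blast
    have fin: "finite (?S f)" using f by blast
    show "f = g"
    proof (rule ext, rule eq_vecI)
      fix t i assume "i < dim_vec (g t)"
      then have i: "i < N" by (simp add: g_def)
      \<comment> \<open>A monomial of coordinate \<open>i\<close> occurs only in the component of
        its own colour, so its coefficient in the sum determines that component.\<close>
      have fl: "Poly_Mapping.lookup (f s $ i) m = 0" if "\<chi> i m \<noteq> s" for s m
        using f i that by (intro lookup_not_supported[of _ "{m \<in> T i. \<chi> i m = s}"]) (auto dest: vec_suppD(3))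
      show "f t $ i = g t $ i"
      proof (rule poly_mapping_eqI)
        fix m
        have "Poly_Mapping.lookup (f t $ i) m = Poly_Mapping.lookup (x $ i) m" if \<chi>: "\<chi> i m = t"
        proof -
          have "x $ i = (\<Sum>s\<in>?S f. f s $ i)"
            using f finsum_index[OF fin fM] i by auto
          then have "Poly_Mapping.lookup (x $ i) m = (\<Sum>s\<in>?S f. Poly_Mapping.lookup (f s $ i) m)"
            by (simp add: lookup_sum)
          also have "\<dots> = (\<Sum>s\<in>?S f. if s = t then Poly_Mapping.lookup (f t $ i) m else 0)"
            using fl \<chi> by (intro sum.cong) auto
          also have "\<dots> = (if t \<in> ?S f then Poly_Mapping.lookup (f t $ i) m else 0)"
            using fin by (simp add: sum.delta)
          also have "\<dots> = Poly_Mapping.lookup (f t $ i) m"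
            using i by auto
          finally show ?thesis by simp
        qed
        then show "Poly_Mapping.lookup (f t $ i) m = Poly_Mapping.lookup (g t $ i) m"
          using fl i by (auto simp: g_def lookup_restr)
      qed
    next
      fix t have "f t \<in> vec_supp N (\<lambda>i. {m \<in> T i. \<chi> i m = t})" using f by blast
      then show "dim_vec (f t) = dim_vec (g t)"
        using vec_suppD(1) by (auto simp: g_def)
    qed
  qed
qed

lemma graded_module: "graded_module n M"
  unfolding graded_module_def
proof (intro conjI allI ballI module)
  \<comment> \<open>The degree j piece of S(t) consists of the polynomials of degree j + t, so a
    monomial in coordinate \<open>i\<close> has its own degree minus \<open>ts ! i\<close>.\<close>
  have "is_direct_sum M (\<lambda>t. vec_supp N (\<lambda>i. {m \<in> T i. int (monom_degree m) - ts ! i = t}))"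
    by (rule direct_sum_by_colour)
  moreover have "deg_part M = (\<lambda>t. vec_supp N (\<lambda>i. {m \<in> T i. int (monom_degree m) - ts ! i = t}))"
    by (auto simp: deg_part fun_eq_iff algebra_simps intro!: vec_supp_cong)
  ultimately show "is_direct_sum M (deg_part M)" by simp
next
  fix i j x and r :: "'k mpoly" assume r: "r \<in> Poly_deg n i" and x: "x \<in> deg_part M j"
  show "r \<odot> x \<in> deg_part M (i + j)"
    unfolding deg_part smult
  proof (rule vec_suppI)
    fix l assume l: "l < N"
    then have "x $ l \<in> supported {m \<in> T l. int (monom_degree m) = j + ts ! l}"
      using x by (auto simp: deg_part dest: vec_suppD(3))
    with r have "r * x $ l \<in> supported {m \<in> T l. int (monom_degree m) = i + j + ts ! l}"
      unfolding Poly_deg_eq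
      by (rule supported_mult) (auto simp: T_def add_monoms monom_degree_add split: if_splits)
    then show "(r \<cdot>\<^sub>v x) $ l \<in> supported {m \<in> T l. int (monom_degree m) = i + j + ts ! l}"
      using l x by (simp add: deg_part vec_suppD)
  qed (use x in \<open>auto simp: deg_part vec_supp_def\<close>)
qed

abbreviation "unit_basis \<equiv> unit_vec N ` (J \<inter> {..<N}) :: 'k mpoly vec set"

lemma unit_vec_carrier: "i \<in> J \<Longrightarrow> i < N \<Longrightarrow> unit_vec N i \<in> carrier M"
  by (auto simp: carrier vec_supp_def T_def unit_vec_def simp flip: single_one)

lemma unit_basis_sum:
  fixes c :: "'k mpoly vec \<Rightarrow> 'k mpoly"
  assumes c: "\<And>b. c b \<in> carrier (Poly_Ring n)" and B: "{b. c b \<noteq> 0} \<subseteq> unit_basis"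
    and i: "i < N"
  shows "finsum M (\<lambda>b. c b \<odot> b) {b. c b \<noteq> 0} $ i = (if i \<in> J then c (unit_vec N i) else 0)"
proof -
  have "unit_basis \<subseteq> carrier M" using unit_vec_carrier by auto
  then have M: "(\<lambda>b. c b \<odot> b) \<in> {b. c b \<noteq> 0} \<rightarrow> carrier M" using B c by blast
  have fin: "finite {b. c b \<noteq> 0}" using finite_subset[OF B] by simp
  have inj: "inj_on (unit_vec N :: nat \<Rightarrow> 'k mpoly vec) (J \<inter> {..<N})"
    by (auto simp: inj_on_def)
  have "finsum M (\<lambda>b. c b \<odot> b) {b. c b \<noteq> 0} $ i = (\<Sum>b\<in>{b. c b \<noteq> 0}. (c b \<odot> b) $ i)"
    using finsum_index[OF fin M] i by blast
  also have "\<dots> = (\<Sum>b\<in>{b. c b \<noteq> 0}. c b * b $ i)"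
    using B i by (intro sum.cong) auto
  also have "\<dots> = (\<Sum>b\<in>unit_basis. c b * b $ i)"
    using B by (intro sum.mono_neutral_left) auto
  also have "\<dots> = (\<Sum>j\<in>J \<inter> {..<N}. c (unit_vec N j) * unit_vec N j $ i)"
    by (rule sum.reindex_cong[OF inj refl]) simp
  also have "\<dots> = (\<Sum>j\<in>J \<inter> {..<N}. if j = i then c (unit_vec N i) else 0)"
    using i by (intro sum.cong) auto
  also have "\<dots> = (if i \<in> J then c (unit_vec N i) else 0)"
    using i by (subst sum.delta) auto
  finally show ?thesis .
qed

lemma basis_unit_basis: "is_basis n M unit_basis"
  unfolding is_basis_def
proof (intro conjI ballI)
  show "unit_basis \<subseteq> carrier M" using unit_vec_carrier by auto
  fix x assume "x \<in> carrier M"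
  then have xN: "x \<in> carrier_vec N" and xT: "\<And>i. i < N \<Longrightarrow> x $ i \<in> supported (T i)"
    by (auto simp: carrier vec_supp_def)
  \<comment> \<open>The coefficient at a unit vector must be the coordinate of \<open>x\<close>
    there, which the scalar product reads off.\<close>
  define g where "g b = (if b \<in> unit_basis then b \<bullet> x else 0)" for b
  have g_unit: "g (unit_vec N i) = x $ i" if "i \<in> J" "i < N" for i
    using that xN by (auto simp: g_def)
  have gP: "g b \<in> carrier (Poly_Ring n)" for b
  proof (cases "b \<in> unit_basis")
    case True
    then obtain i where "i \<in> J" "i < N" "b = unit_vec N i" by auto
    then show ?thesis using g_unit xT[of i] by (simp add: carrier_Poly_Ring T_def)
  qed (auto simp: g_def Poly_Ring_zero)
  have gB: "{b. g b \<noteq> 0} \<subseteq> unit_basis" by (auto simp: g_def)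
  have dim: "finsum M (\<lambda>b. c b \<odot> b) {b. c b \<noteq> 0} \<in> carrier_vec N"
    if "\<And>b. c b \<in> carrier (Poly_Ring n)" "{b. c b \<noteq> 0} \<subseteq> unit_basis" for c
  proof (rule finsum_index[THEN conjunct1])
    show "finite {b. c b \<noteq> 0}" using finite_subset[OF that(2)] by simp
    have "unit_basis \<subseteq> carrier M" using unit_vec_carrier by auto
    then show "(\<lambda>b. c b \<odot> b) \<in> {b. c b \<noteq> 0} \<rightarrow> carrier M" using that by blast
  qed
  show "\<exists>!c. (\<forall>b. c b \<in> carrier (Poly_Ring n)) \<and> {b. c b \<noteq> 0} \<subseteq> unit_basis \<and>
        finite {b. c b \<noteq> 0} \<and> x = finsum M (\<lambda>b. c b \<odot> b) {b. c b \<noteq> 0}"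
  proof (rule ex1I[of _ g], intro conjI allI gP gB)
    show "finite {b. g b \<noteq> 0}" using finite_subset[OF gB] by simp
    show "x = finsum M (\<lambda>b. g b \<odot> b) {b. g b \<noteq> 0}"
    proof (rule eq_vecI)
      fix i assume "i < dim_vec (finsum M (\<lambda>b. g b \<odot> b) {b. g b \<noteq> 0})"
      then have i: "i < N" using dim[OF gP gB] by auto
      have "x $ i = 0" if "i \<notin> J" using xT[OF i] that by (simp add: T_def supported_def)
      then show "x $ i = finsum M (\<lambda>b. g b \<odot> b) {b. g b \<noteq> 0} $ i"
        using unit_basis_sum[OF gP gB i] g_unit i by auto
    qed (use dim[OF gP gB] xN in auto)
  next
    fix c assume c: "(\<forall>b. c b \<in> carrier (Poly_Ring n)) \<and> {b. c b \<noteq> 0} \<subseteq> unit_basis \<and>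
        finite {b. c b \<noteq> 0} \<and> x = finsum M (\<lambda>b. c b \<odot> b) {b. c b \<noteq> 0}"
    show "c = g"
    proof
      fix b
      show "c b = g b"
      proof (cases "b \<in> unit_basis")
        case True
        then obtain i where i: "i \<in> J" "i < N" "b = unit_vec N i" by auto
        have "x $ i = c b" using unit_basis_sum[of c i] c i by simp
        then show ?thesis using g_unit i by simp
      next
        case False
        then show ?thesis using c by (auto simp: g_def)
      qed
    qed
  qed
qed

lemma graded_free: "graded_free n M"
proof -
  have "unit_vec N i \<in> deg_part M (- (ts ! i))" if "i \<in> J" "i < N" for i
    using that by (auto simp: deg_part vec_supp_def unit_vec_def T_def simp flip: single_one)
  then have "unit_basis \<subseteq> (\<Union>j. deg_part M j)" by blast
  then show ?thesis
    unfolding graded_free_def using graded_module basis_unit_basis by blast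
qed

end

lemma matrix_dmod_simps [simp]:
  "add (matrix_dmod n ts A) = (+)" "zero (matrix_dmod n ts A) = 0\<^sub>v (length ts)"
  "smult (matrix_dmod n ts A) = (\<cdot>\<^sub>v)" "differential (matrix_dmod n ts A) = (\<lambda>v. A *\<^sub>v v)"
  by (simp_all add: matrix_dmod_def)

lemma carrier_matrix_dmod: "carrier (matrix_dmod n ts A) = vec_supp (length ts) (\<lambda>_. monoms n)"
  by (simp add: matrix_dmod_def vec_supp_def carrier_Poly_Ring)

lemma deg_part_matrix_dmod: "deg_part (matrix_dmod n ts A) j =
    vec_supp (length ts) (\<lambda>i. {m \<in> monoms n. int (monom_degree m) = j + ts ! i})"
  by (simp add: matrix_dmod_def vec_supp_def Poly_deg_eq)

interpretation matrix_dmod: coordinate_module n ts UNIV "matrix_dmod n ts A"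
    "\<lambda>i. if i \<in> UNIV then monoms n else {}" "length ts" for n ts A
  by unfold_locales (simp_all add: carrier_matrix_dmod deg_part_matrix_dmod)


section \<open>Homogeneous matrices\<close>

text \<open>Matrices of degree \<open>a\<close> from the direct sum of the \<open>S(t)\<close>, \<open>t \<in> ts\<close>, to that of the \<open>S(s)\<close>, \<open>s \<in> ss\<close>.\<close>

definition hmat :: "nat \<Rightarrow> int \<Rightarrow> int list \<Rightarrow> int list \<Rightarrow> 'k::field mpoly mat \<Rightarrow> bool" where
  "hmat n a ts ss P \<longleftrightarrow> P \<in> carrier_mat (length ss) (length ts) \<and>
     (\<forall>i<length ss. \<forall>j<length ts. P $$ (i, j) \<in> Poly_deg n (a + ss ! i - ts ! j))"

lemma index_mult_mat_vec_sum:
  "A \<in> carrier_mat r c \<Longrightarrow> v \<in> carrier_vec c \<Longrightarrow> i < r \<Longrightarrow> (A *\<^sub>v v) $ i = (\<Sum>j<c. A $$ (i, j) * v $ j)"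
  by (auto simp: scalar_prod_def lessThan_atLeast0 intro!: sum.cong)

lemma hmat_mult_deg:
  assumes P: "hmat n a ts ss P" and v: "v \<in> deg_part (matrix_dmod n ts A) j"
  shows "P *\<^sub>v v \<in> deg_part (matrix_dmod n ss B) (j + a)"
proof -
  have PC: "P \<in> carrier_mat (length ss) (length ts)" using P by (simp add: hmat_def)
  have vC: "v \<in> carrier_vec (length ts)" and vd: "\<And>l. l < length ts \<Longrightarrow> v $ l \<in> Poly_deg n (j + ts ! l)"
    using v by (auto simp: matrix_dmod_def)
  have "(P *\<^sub>v v) $ i \<in> Poly_deg n (j + a + ss ! i)" if i: "i < length ss" for i
    unfolding index_mult_mat_vec_sum[OF PC vC i]
  proof (rule Poly_deg_sum)
    fix l assume "l \<in> {..<length ts}"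
    then have l: "l < length ts" by simp
    have "P $$ (i, l) * v $ l \<in> Poly_deg n ((a + ss ! i - ts ! l) + (j + ts ! l))"
      using P i l by (intro Poly_deg_mult vd) (auto simp: hmat_def)
    then show "P $$ (i, l) * v $ l \<in> Poly_deg n (j + a + ss ! i)"
      by (simp add: algebra_simps)
  qed
  then show ?thesis using mult_mat_vec_carrier[OF PC vC] by (simp add: matrix_dmod_def)
qed

lemma hmat_mult_carrier:
  assumes P: "hmat n a ts ss P" and v: "v \<in> carrier (matrix_dmod n ts A)"
  shows "P *\<^sub>v v \<in> carrier (matrix_dmod n ss B)"
proof -
  have PC: "P \<in> carrier_mat (length ss) (length ts)" using P by (simp add: hmat_def)
  have vC: "v \<in> carrier_vec (length ts)" and vd: "\<And>l. l < length ts \<Longrightarrow> v $ l \<in> carrier (Poly_Ring n)"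
    using v by (auto simp: matrix_dmod_def)
  have "(P *\<^sub>v v) $ i \<in> carrier (Poly_Ring n)" if i: "i < length ss" for i
    unfolding index_mult_mat_vec_sum[OF PC vC i]
    using P i by (intro Poly_Ring_sum Poly_Ring_mult vd) (auto simp: hmat_def intro: Poly_deg_carrier)
  then show ?thesis using mult_mat_vec_carrier[OF PC vC] by (simp add: matrix_dmod_def)
qed

lemma matrix_dmod_carrier_vec: "v \<in> carrier (matrix_dmod n ts A) \<Longrightarrow> v \<in> carrier_vec (length ts)"
  by (simp add: matrix_dmod_def)

lemma hmat_linear: "hmat n a ts ss P \<Longrightarrow> linear_map n (matrix_dmod n ts A) (matrix_dmod n ss B) (\<lambda>v. P *\<^sub>v v)"
  unfolding linear_map_def
proof (intro conjI ballI)
  assume P: "hmat n a ts ss P"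
  then have PC: "P \<in> carrier_mat (length ss) (length ts)" by (simp add: hmat_def)
  show "(\<lambda>v. P *\<^sub>v v) \<in> carrier (matrix_dmod n ts A) \<rightarrow> carrier (matrix_dmod n ss B)"
    using hmat_mult_carrier[OF P] by blast
qed (auto simp: hmat_def mult_add_distrib_mat_vec mult_mat_vec dest!: matrix_dmod_carrier_vec)

section \<open>Differential modules, morphisms, flags and minimality in terms of matrices\<close>

lemma diff_module_matrix_dmod:
  assumes A: "hmat n a ts ts A" and AA: "A * A = 0\<^sub>m (length ts) (length ts)"
  shows "diff_module n a (matrix_dmod n ts A)"
proof -
  have AC: "A \<in> carrier_mat (length ts) (length ts)" using A by (simp add: hmat_def)
  have "A *\<^sub>v (A *\<^sub>v v) = 0\<^sub>v (length ts)" if "v \<in> carrier_vec (length ts)" for v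
  proof -
    have "A *\<^sub>v (A *\<^sub>v v) = 0\<^sub>m (length ts) (length ts) *\<^sub>v v"
      using assoc_mult_mat_vec[OF AC AC that] by (simp add: AA)
    also have "\<dots> = 0\<^sub>v (length ts)"
      using that by (intro eq_vecI) auto
    finally show ?thesis .
  qed
  then show ?thesis
    unfolding diff_module_def graded_hom_def
    using matrix_dmod.graded_module[of n ts A] hmat_linear[OF A, of A A] hmat_mult_deg[OF A, of _ A _ A]
    by (auto simp: linear_map_def dest!: matrix_dmod_carrier_vec)
qed

lemma dm_morphism_matrix_dmod:
  assumes P: "hmat n 0 ts ss P" and A: "A \<in> carrier_mat (length ts) (length ts)"
    and B: "B \<in> carrier_mat (length ss) (length ss)" and PA: "P * A = B * P"
  shows "dm_morphism n (matrix_dmod n ts A) (matrix_dmod n ss B) (\<lambda>v. P *\<^sub>v v)"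
proof -
  have PC: "P \<in> carrier_mat (length ss) (length ts)" using P by (simp add: hmat_def)
  have "P *\<^sub>v (A *\<^sub>v v) = B *\<^sub>v (P *\<^sub>v v)" if "v \<in> carrier_vec (length ts)" for v
    unfolding assoc_mult_mat_vec[OF PC A that, symmetric] assoc_mult_mat_vec[OF B PC that, symmetric] PA ..
  then show ?thesis
    unfolding dm_morphism_def graded_hom_def
    using hmat_linear[OF P] hmat_mult_deg[OF P, of _ A _ B]
    by (auto dest!: matrix_dmod_carrier_vec)
qed

lemma free_diff_module_matrix_dmod:
  "hmat n a ts ts A \<Longrightarrow> A * A = 0\<^sub>m (length ts) (length ts) \<Longrightarrow> free_diff_module n a (matrix_dmod n ts A)"
  by (simp add: free_diff_module_def diff_module_matrix_dmod matrix_dmod.graded_free)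

text \<open>Each coordinate is one layer, and strict upper triangularity sends it into the earlier
  ones. Layers with an index beyond the rank are zero, hence free on the empty basis.\<close>

lemma free_flag_matrix_dmod:
  fixes E :: "'k::field mpoly mat"
  assumes E: "hmat n a ts ts E" and EE: "E * E = 0\<^sub>m (length ts) (length ts)"
    and upper: "\<And>i j. i < length ts \<Longrightarrow> j \<le> i \<Longrightarrow> E $$ (i, j) = 0"
  shows "free_flag n a (matrix_dmod n ts E)"
proof -
  let ?M = "matrix_dmod n ts E" and ?N = "length ts"
  let ?A = "\<lambda>i. vec_supp ?N (\<lambda>l. {m \<in> monoms n. l = i}) :: 'k mpoly vec set"
  have EC: "E \<in> carrier_mat ?N ?N" using E by (simp add: hmat_def)
  have "is_direct_sum ?M ?A"
    using matrix_dmod.direct_sum_by_colour[of n ts E "\<lambda>l m. l"] by simp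
  moreover have "graded_free n (sub_gmod ?M (?A i))" for i
  proof -
    interpret coordinate_module n ts "{i}" "sub_gmod ?M (?A i)"
        "\<lambda>l. if l \<in> {i} then monoms n else {}" ?N
      by unfold_locales
        (auto simp: deg_part_matrix_dmod vec_supp_Int intro!: vec_supp_cong split: if_splits)
    show ?thesis by (rule graded_free)
  qed
  moreover have "\<exists>y. (\<forall>j<i. y j \<in> ?A j) \<and> E *\<^sub>v x = finsum ?M y {..<i}" if x: "x \<in> ?A i" for i x
  proof -
    have xC: "x \<in> carrier_vec ?N" using x by (rule vec_suppD(2))
    have x0: "x $ l = 0" if "l < ?N" "l \<noteq> i" for l
      using vec_suppD(3)[OF x that(1)] that by (simp add: supported_def)
    have Ex0: "(E *\<^sub>v x) $ l = 0" if l: "l < ?N" "i \<le> l" for l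
      unfolding index_mult_mat_vec_sum[OF EC xC l(1)]
    proof (rule sum.neutral, rule ballI)
      fix j assume "j \<in> {..<?N}"
      then show "E $$ (l, j) * x $ j = 0"
        using x0[of j] upper[of l i] l by (cases "j = i") auto
    qed
    have "x \<in> carrier ?M" using x by (auto simp: carrier_matrix_dmod elim: vec_supp_mono)
    then have Ex: "E *\<^sub>v x \<in> carrier ?M" by (rule hmat_mult_carrier[OF E])
    then have ExC: "E *\<^sub>v x \<in> carrier_vec ?N" by (rule matrix_dmod_carrier_vec)
    define y where "y j = vec ?N (\<lambda>l. if l = j then (E *\<^sub>v x) $ l else 0)" for j
    have y: "y j \<in> ?A j" for j
      using Ex by (auto simp: y_def carrier_matrix_dmod vec_supp_def)
    have "y j \<in> carrier ?M" for j
      unfolding carrier_matrix_dmod by (rule vec_supp_mono[OF y]) auto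
    then have "y \<in> {..<i} \<rightarrow> carrier ?M" by simp
    then have fs: "finsum ?M y {..<i} \<in> carrier_vec ?N"
        "\<And>l. l < ?N \<Longrightarrow> finsum ?M y {..<i} $ l = (\<Sum>j<i. y j $ l)"
      using matrix_dmod.finsum_index[of "{..<i}" y n ts E] by auto
    have "E *\<^sub>v x = finsum ?M y {..<i}"
    proof (rule eq_vecI)
      fix l assume "l < dim_vec (finsum ?M y {..<i})"
      then have l: "l < ?N" using fs by auto
      have "(\<Sum>j<i. y j $ l) = (\<Sum>j<i. if j = l then (E *\<^sub>v x) $ l else 0)"
        using l by (intro sum.cong) (auto simp: y_def)
      \<comment> \<open>The coordinates l with i \<le> l are missing from the sum, and there E x
        vanishes.\<close>
      also have "\<dots> = (E *\<^sub>v x) $ l" using Ex0[OF l] by (auto simp: sum.delta)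
      finally show "(E *\<^sub>v x) $ l = finsum ?M y {..<i} $ l" using fs l by simp
    qed (use fs ExC EC in auto)
    with y show ?thesis by blast
  qed
  ultimately show ?thesis
    unfolding free_flag_def using diff_module_matrix_dmod[OF E EE] by auto
qed

text \<open>A x is the sum of its coordinates times unit vectors. The coordinates lie in the maximal
  ideal, so each summand is a generator of \<open>max_ideal_times\<close>, and the differential
  induces zero on the quotient.\<close>

lemma minimal_matrix_dmod:
  assumes A: "hmat n a ts ts A" and AA: "A * A = 0\<^sub>m (length ts) (length ts)"
    and max: "\<And>i j. i < length ts \<Longrightarrow> j < length ts \<Longrightarrow> A $$ (i, j) \<in> max_ideal n"
  shows "minimal n a (matrix_dmod n ts A)"
proof -
  let ?M = "matrix_dmod n ts A" and ?N = "length ts"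
  have AC: "A \<in> carrier_mat ?N ?N" using A by (simp add: hmat_def)
  let ?G = "{r \<odot>\<^bsub>?M\<^esub> x | r x. r \<in> max_ideal n \<and> x \<in> carrier ?M}"
  let ?m = "max_ideal_times n ?M"
  have G: "?G \<subseteq> carrier ?M" unfolding max_ideal_def using matrix_dmod.smult_closed by blast
  have sub: "subgroup ?m (add_monoid ?M)"
    unfolding max_ideal_times_def by (rule matrix_dmod.add.generate_is_subgroup) (use G in auto)
  have Gm: "?G \<subseteq> ?m" unfolding max_ideal_times_def by (auto intro: generate.incl)
  have d: "A *\<^sub>v x \<in> ?m" if x: "x \<in> carrier ?M" for x
  proof -
    have xC: "x \<in> carrier_vec ?N" using x by (rule matrix_dmod_carrier_vec)
    have "(A *\<^sub>v x) $ i \<in> max_ideal n" if "i < ?N" for i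
      unfolding index_mult_mat_vec_sum[OF AC xC that]
      using x that by (intro max_ideal_sum max_ideal_mult max) (auto simp: matrix_dmod_def)
    then have e: "(A *\<^sub>v x) $ i \<cdot>\<^sub>v unit_vec ?N i \<in> ?G" if "i < ?N" for i
      using that matrix_dmod.unit_vec_carrier[of i ts n A] by auto
    let ?e = "\<lambda>i. (A *\<^sub>v x) $ i \<cdot>\<^sub>v unit_vec ?N i"
    have eM: "?e \<in> {..<?N} \<rightarrow> carrier ?M" using e G by blast
    have "finsum ?M ?e X \<in> ?m" if "X \<subseteq> {..<?N}" for X
      using finite_subset[OF that finite_lessThan] that
    proof (induction X rule: finite_induct)
      case empty
      then show ?case using subgroup.one_closed[OF sub] by simp
    next
      case (insert i X)
      then have "finsum ?M ?e (insert i X) = ?e i \<oplus>\<^bsub>?M\<^esub> finsum ?M ?e X"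
        using eM by (intro matrix_dmod.finsum_insert) auto
      moreover have "?e i \<in> ?m" using insert e Gm by blast
      ultimately show ?case using subgroup.m_closed[OF sub] insert by simp
    qed
    then have "finsum ?M ?e {..<?N} \<in> ?m" by blast
    moreover have "A *\<^sub>v x = finsum ?M ?e {..<?N}"
    proof (rule eq_vecI)
      have fi: "finsum ?M ?e {..<?N} \<in> carrier_vec ?N"
        "\<And>i. i < ?N \<Longrightarrow> finsum ?M ?e {..<?N} $ i = (\<Sum>j<?N. ?e j $ i)"
        using matrix_dmod.finsum_index[OF _ eM] by auto
      show "dim_vec (A *\<^sub>v x) = dim_vec (finsum ?M ?e {..<?N})" using fi AC by auto
      fix i assume "i < dim_vec (finsum ?M ?e {..<?N})"
      then have i: "i < ?N" using fi by auto
      have "(\<Sum>j<?N. ?e j $ i) = (\<Sum>j<?N. if j = i then (A *\<^sub>v x) $ i else 0)"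
        using i by (intro sum.cong) auto
      also have "\<dots> = (A *\<^sub>v x) $ i" using i by (simp add: sum.delta)
      finally show "(A *\<^sub>v x) $ i = finsum ?M ?e {..<?N} $ i" using fi i by simp
    qed
    ultimately show ?thesis by simp
  qed
  have "induced_map ?M ?m (differential ?M) B = \<zero>\<^bsub>tensor_k n ?M\<^esub>" if B: "B \<in> carrier (tensor_k n ?M)" for B
  proof -
    obtain x where x: "x \<in> carrier ?M" "B = ?m +>\<^bsub>?M\<^esub> x"
      using B by (auto simp: tensor_k_def quot_gmod_def A_RCOSETS_def')
    have "?m \<subseteq> carrier ?M" using subgroup.subset[OF sub] by simp
    then have BM: "B \<subseteq> carrier ?M" using x matrix_dmod.a_r_coset_subset_G by simp
    \<comment> \<open>The induced map is a union over \<open>B\<close>; as \<open>B\<close> is not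
      empty, the union is the zero coset and not the empty set.\<close>
    have "x \<in> B" using x subgroup.one_closed[OF sub] x by (force simp: a_r_coset_def' dest: matrix_dmod_carrier_vec)
    moreover have "?m +>\<^bsub>?M\<^esub> (A *\<^sub>v y) = ?m" if "y \<in> B" for y
      using that BM d[of y] sub \<open>?m \<subseteq> carrier ?M\<close> by (intro matrix_dmod.a_coset_join2) auto
    ultimately show ?thesis
      by (auto simp: induced_map_def tensor_k_def quot_gmod_def)
  qed
  then show ?thesis
    unfolding minimal_def using free_diff_module_matrix_dmod[OF A AA] by blast
qed


section \<open>The recursion for \<open>D\<^sub>n\<close> as a mapping cone\<close>

lemma hmat_carrier: "hmat n a ts ss P \<Longrightarrow> P \<in> carrier_mat (length ss) (length ts)"
  by (simp add: hmat_def)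

lemma hmat_mono: "hmat n a ts ss P \<Longrightarrow> n \<le> m \<Longrightarrow> hmat m a ts ss P"
  by (auto simp: hmat_def intro: Poly_deg_mono)

lemma hmat_uminus: "hmat n a ts ss P \<Longrightarrow> hmat n a ts ss (- P)"
  by (auto simp: hmat_def Poly_deg_uminus)

lemma hmat_zero: "hmat n a ts ss (0\<^sub>m (length ss) (length ts))"
  by (simp add: hmat_def)

lemma hmat_shift: "hmat n a (map (\<lambda>t. t + b) ts) (map (\<lambda>t. t + b) ss) P \<longleftrightarrow> hmat n a ts ss P"
  by (simp add: hmat_def algebra_simps)

text \<open>The entry has degree 2 + t - (t + 1) = 1: the twist by 1 on the second summand of a cone
  is what makes multiplication by a variable a map of degree 2.\<close>

lemma hmat_Var:
  "1 \<le> i \<Longrightarrow> i \<le> n \<Longrightarrow> hmat n 2 (map (\<lambda>t. t + 1) ts) ts (Var i \<cdot>\<^sub>m 1\<^sub>m (length ts))"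
  by (auto simp: hmat_def Poly_deg_Var)

lemma hmat_four_block:
  assumes "hmat n a t1 s1 A" "hmat n a t2 s1 B" "hmat n a t1 s2 C" "hmat n a t2 s2 D"
  shows "hmat n a (t1 @ t2) (s1 @ s2) (four_block_mat A B C D)"
proof -
  have "A \<in> carrier_mat (length s1) (length t1)" "D \<in> carrier_mat (length s2) (length t2)"
    using assms by (auto simp: hmat_def)
  then show ?thesis
    using assms by (auto simp: hmat_def nth_append)
qed

definition cone :: "'k::field mpoly \<Rightarrow> 'k mpoly mat \<Rightarrow> 'k mpoly mat" where
  "cone x A = four_block_mat (- A) (x \<cdot>\<^sub>m 1\<^sub>m (dim_row A)) (0\<^sub>m (dim_row A) (dim_row A)) A"

text \<open>The map that a morphism induces between cones: the same matrix on both summands.\<close>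

definition dbl :: "'k::field mpoly mat \<Rightarrow> 'k mpoly mat" where
  "dbl P = four_block_mat P (0\<^sub>m (dim_row P) (dim_col P)) (0\<^sub>m (dim_row P) (dim_col P)) P"

lemma uminus_mult_uminus_mat:
  "A \<in> carrier_mat r k \<Longrightarrow> B \<in> carrier_mat k l \<Longrightarrow> - A * - B = A * (B :: 'a::comm_ring_1 mat)"
  by (rule eq_matI) (auto simp: scalar_prod_def sum_negf)

text \<open>The off-diagonal block is x A - x A; the sign on the first summand makes it
  cancel.\<close>

lemma cone_square:
  assumes A: "A \<in> carrier_mat r r" and AA: "A * A = 0\<^sub>m r r"
  shows "cone x A * cone x A = 0\<^sub>m (r + r) (r + r)"
proof -
  have "cone x A * cone x A = four_block_mat (- A * - A + (x \<cdot>\<^sub>m 1\<^sub>m r) * 0\<^sub>m r r)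
      (- A * (x \<cdot>\<^sub>m 1\<^sub>m r) + (x \<cdot>\<^sub>m 1\<^sub>m r) * A) (0\<^sub>m r r * - A + A * 0\<^sub>m r r)
      (0\<^sub>m r r * (x \<cdot>\<^sub>m 1\<^sub>m r) + A * A)"
    unfolding cone_def using A by (subst mult_four_block_mat[of _ r r _ r _ r _ _ r _ r]) auto
  also have "\<dots> = four_block_mat (0\<^sub>m r r) (0\<^sub>m r r) (0\<^sub>m r r) (0\<^sub>m r r)"
    using A AA by (intro cong_four_block_mat)
      (auto simp: uminus_mult_uminus_mat mult_smult_distrib mult_smult_assoc_mat)
  finally show ?thesis by simp
qed

lemma dbl_mult: "P \<in> carrier_mat r k \<Longrightarrow> Q \<in> carrier_mat k l \<Longrightarrow> dbl P * dbl Q = dbl (P * Q)"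
  unfolding dbl_def by (subst mult_four_block_mat[of _ r k _ k _ r _ _ l _ l]) auto

lemma dbl_one: "dbl (1\<^sub>m r) = 1\<^sub>m (r + r)"
  by (simp add: dbl_def)

text \<open>Scalar matrices commute with \<open>P\<close>, so compatibility with the differentials
  passes to the cones.\<close>

lemma dbl_cone:
  assumes P: "P \<in> carrier_mat r k" and A: "A \<in> carrier_mat k k" and B: "B \<in> carrier_mat r r"
    and PA: "P * A = B * P"
  shows "dbl P * cone x A = cone x B * dbl P"
proof -
  have "dbl P * cone x A = four_block_mat (P * - A) (P * (x \<cdot>\<^sub>m 1\<^sub>m k)) (0\<^sub>m r k) (P * A)"
    unfolding cone_def dbl_def using P A
    by (subst mult_four_block_mat[of _ r k _ k _ r _ _ k _ k]) auto
  also have "\<dots> = four_block_mat (- B * P) ((x \<cdot>\<^sub>m 1\<^sub>m r) * P) (0\<^sub>m r k) (B * P)"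
    using P A B PA by (intro cong_four_block_mat) (auto simp: mult_smult_distrib mult_smult_assoc_mat)
  also have "\<dots> = cone x B * dbl P"
    unfolding cone_def dbl_def using P B
    by (subst mult_four_block_mat[of _ r r _ r _ r _ _ k _ k]) auto
  finally show ?thesis .
qed

text \<open>The homotopy carries the same sign on the first summand as the cone. The signs cancel in
  the diagonal blocks, and the two products contribute x s and - x s to the off-diagonal
  block.\<close>

lemma cone_homotopy:
  assumes E: "E \<in> carrier_mat r r" and s: "s \<in> carrier_mat r r" and R: "R \<in> carrier_mat r r"
    and h: "E * s + s * E + R = 1\<^sub>m r"
  defines "t \<equiv> four_block_mat (- s) (0\<^sub>m r r) (0\<^sub>m r r) s"
  shows "cone x E * t + t * cone x E + dbl R = 1\<^sub>m (r + r)"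
proof -
  have x: "(x \<cdot>\<^sub>m 1\<^sub>m r) * s = x \<cdot>\<^sub>m s" "s * (x \<cdot>\<^sub>m 1\<^sub>m r) = x \<cdot>\<^sub>m s"
    using s by (auto simp: mult_smult_assoc_mat[OF one_carrier_mat s] mult_smult_distrib[OF s one_carrier_mat])
  have z: "- 0\<^sub>m r r = (0\<^sub>m r r :: 'a mpoly mat)" by (rule eq_matI) auto
  have 1: "cone x E * t = four_block_mat (E * s) (x \<cdot>\<^sub>m s) (0\<^sub>m r r) (E * s)"
    unfolding cone_def t_def using E s
    by (subst mult_four_block_mat[of _ r r _ r _ r _ _ r _ r])
      (auto simp: uminus_mult_uminus_mat x z)
  have 2: "t * cone x E = four_block_mat (s * E) (- (x \<cdot>\<^sub>m s)) (0\<^sub>m r r) (s * E)"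
    unfolding cone_def t_def using E s
    by (subst mult_four_block_mat[of _ r r _ r _ r _ _ r _ r])
      (auto simp: uminus_mult_uminus_mat x z)
  have "cone x E * t + t * cone x E + dbl R =
      four_block_mat (E * s + s * E + R) (x \<cdot>\<^sub>m s + - (x \<cdot>\<^sub>m s) + 0\<^sub>m r r) (0\<^sub>m r r) (E * s + s * E + R)"
    unfolding 1 2 dbl_def using E s R
    by (subst add_four_block_mat[of _ r r _ r _ r], auto)+
  also have "\<dots> = four_block_mat (1\<^sub>m r) (0\<^sub>m r r) (0\<^sub>m r r) (1\<^sub>m r)"
    unfolding h using s by (intro cong_four_block_mat) auto
  finally show ?thesis by simp
qed

lemma cone_mult_vec:
  assumes A: "A \<in> carrier_mat r r" and u: "u \<in> carrier_vec r" and w: "w \<in> carrier_vec r"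
  shows "cone x A *\<^sub>v (u @\<^sub>v w) = (x \<cdot>\<^sub>v w - A *\<^sub>v u) @\<^sub>v (A *\<^sub>v w)"
proof -
  have "cone x A *\<^sub>v (u @\<^sub>v w) =
      (- A *\<^sub>v u + (x \<cdot>\<^sub>m 1\<^sub>m r) *\<^sub>v w) @\<^sub>v (0\<^sub>m r r *\<^sub>v u + A *\<^sub>v w)"
    unfolding cone_def using A u w by (subst four_block_mat_mult_vec[of _ r r _ r _ r]) auto
  also have "\<dots> = (x \<cdot>\<^sub>v w - A *\<^sub>v u) @\<^sub>v (A *\<^sub>v w)"
  proof (rule arg_cong2[of _ _ _ _ "(@\<^sub>v)"])
    have "(x \<cdot>\<^sub>m 1\<^sub>m r) *\<^sub>v w = x \<cdot>\<^sub>v w"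
      using w by (intro eq_vecI) auto
    then show "- A *\<^sub>v u + (x \<cdot>\<^sub>m 1\<^sub>m r) *\<^sub>v w = x \<cdot>\<^sub>v w - A *\<^sub>v u"
      using A u w by (intro eq_vecI) auto
    show "0\<^sub>m r r *\<^sub>v u + A *\<^sub>v w = A *\<^sub>v w"
      using A u w by (intro eq_vecI) auto
  qed
  finally show ?thesis .
qed

section \<open>The matrices of D_n as iterated cones\<close>

lemma D_matrix_2: "D_matrix 2 = D2_matrix"
  by (simp add: numeral_2_eq_2)

lemma D_twists_2: "D_twists c 2 = [c, c]"
  by (simp add: numeral_2_eq_2)

lemma D_matrix_Suc: "2 \<le> n \<Longrightarrow> D_matrix (Suc n) = cone (Var (Suc n)) (D_matrix n)"
  by (simp add: cone_def Let_def)

lemma D_twists_Suc: "2 \<le> n \<Longrightarrow> D_twists c (Suc n) = D_twists c n @ map (\<lambda>t. t + 1) (D_twists c n)"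
  by simp

declare D_matrix.simps [simp del] D_twists.simps [simp del]

lemma D_matrix_carrier: "2 \<le> n \<Longrightarrow> D_matrix n \<in> carrier_mat (length (D_twists c n)) (length (D_twists c n))"
  using dim_D_matrix length_D_twists by metis

lemma hmat_cone:
  assumes "hmat n 2 ts ts A"
  shows "hmat (Suc n) 2 (ts @ map (\<lambda>t. t + 1) ts) (ts @ map (\<lambda>t. t + 1) ts) (cone (Var (Suc n)) A)"
proof -
  have A: "hmat (Suc n) 2 ts ts A" using assms by (rule hmat_mono) simp
  have r: "dim_row A = length ts" using hmat_carrier[OF A] by simp
  show ?thesis
    unfolding cone_def r
    using A hmat_zero[of "Suc n" 2 ts "map (\<lambda>t. t + 1) ts"]
    by (intro hmat_four_block hmat_uminus hmat_Var) (simp_all add: hmat_shift)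
qed

lemma hmat_blocks:
  assumes "hmat n a ts ss A" "hmat n a ts ss B"
  shows "hmat (Suc n) a (ts @ map (\<lambda>t. t + 1) ts) (ss @ map (\<lambda>t. t + 1) ss)
    (four_block_mat A (0\<^sub>m (length ss) (length ts)) (0\<^sub>m (length ss) (length ts)) B)"
proof -
  have AB: "hmat (Suc n) a ts ss A" "hmat (Suc n) a ts ss B"
    using assms by (auto elim: hmat_mono)
  show ?thesis
    using AB hmat_zero[of "Suc n" a ts "map (\<lambda>t. t + 1) ss"] hmat_zero[of "Suc n" a "map (\<lambda>t. t + 1) ts" ss]
    by (intro hmat_four_block) (simp_all add: hmat_shift)
qed

lemma less_Suc_Suc_0_iff: "i < Suc (Suc 0) \<longleftrightarrow> i = 0 \<or> i = Suc 0"
  by auto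

lemmas small_mat_simps = mat_of_rows_list_def scalar_prod_def less_Suc_eq numeral_2_eq_2 numeral_3_eq_3
  numeral_eq_Suc power2_eq_square algebra_simps

lemma hmat_D_matrix: "2 \<le> n \<Longrightarrow> hmat n 2 (D_twists c n) (D_twists c n) (D_matrix n :: 'k::field mpoly mat)"
proof (induction n rule: nat_induct_at_least)
  case base
  have V: "(Var 1 :: 'k mpoly) \<in> Poly_deg 2 1" "(Var 2 :: 'k mpoly) \<in> Poly_deg 2 1"
    by (auto intro: Poly_deg_Var)
  have "p * q \<in> Poly_deg 2 2" if "p \<in> Poly_deg 2 1" "q \<in> Poly_deg 2 1" for p q :: "'k mpoly"
    using Poly_deg_mult[OF that] by simp
  then show ?case
    using V by (auto simp: D_matrix_2 D_twists_2 hmat_def D2_matrix_def mat_of_rows_list_def less_Suc_Suc_0_iff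
        power2_eq_square intro!: Poly_deg_uminus)
next
  case (Suc n)
  then show ?case using hmat_cone by (auto simp: D_matrix_Suc D_twists_Suc)
qed

lemma D_matrix_square:
  "2 \<le> n \<Longrightarrow> D_matrix n * D_matrix n = (0\<^sub>m (2 ^ (n - 1)) (2 ^ (n - 1)) :: 'k::field mpoly mat)"
proof (induction n rule: nat_induct_at_least)
  case base
  show ?case
    unfolding D_matrix_2 by (rule eq_matI) (auto simp: D2_matrix_def small_mat_simps)
next
  case (Suc n)
  then have "(2::nat) ^ (Suc n - 1) = 2 ^ (n - 1) + 2 ^ (n - 1)" by (cases n) auto
  then show ?case
    using cone_square[OF dim_D_matrix Suc.IH] Suc.hyps by (simp add: D_matrix_Suc)
qed

lemma D_matrix_max_ideal:
  "2 \<le> n \<Longrightarrow> i < 2 ^ (n - 1) \<Longrightarrow> j < 2 ^ (n - 1) \<Longrightarrow> (D_matrix n :: 'k::field mpoly mat) $$ (i, j) \<in> max_ideal n"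
proof (induction n arbitrary: i j rule: nat_induct_at_least)
  case base
  have "hmat 2 2 [0, 0] [0, 0] (D2_matrix :: 'k mpoly mat)"
    using hmat_D_matrix[of 2 0] by (simp add: D_matrix_2 D_twists_2)
  then show ?case
    using base by (intro max_ideal_Poly_deg[of _ _ 2]) (auto simp: hmat_def D_matrix_2 less_2_cases_iff less_Suc_Suc_0_iff)
next
  case (Suc n)
  have e: "(2::nat) ^ (Suc n - 1) = 2 ^ (n - 1) + 2 ^ (n - 1)"
    using Suc.hyps by (cases n) auto
  have "p \<in> max_ideal n \<Longrightarrow> p \<in> max_ideal (Suc n)" "p \<in> max_ideal n \<Longrightarrow> - p \<in> max_ideal (Suc n)" for p :: "'k mpoly"
    unfolding max_ideal_eq by (auto simp: monoms_def intro!: supported_uminus elim!: supported_mono)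
  moreover have "Var (Suc n) \<in> (max_ideal (Suc n) :: 'k mpoly set)"
    by (rule max_ideal_Poly_deg[OF Poly_deg_Var]) auto
  moreover have "0 \<in> (max_ideal (Suc n) :: 'k mpoly set)"
    by (simp add: max_ideal_eq)
  ultimately show ?case
    using Suc.prems Suc.IH dim_D_matrix[OF Suc.hyps, where 'k = 'k] unfolding e
    by (auto simp: D_matrix_Suc Suc.hyps cone_def)
qed

section \<open>A free flag containing \<open>D\<^sub>n\<close> as a summand\<close>

text \<open>For \<open>n = 2\<close> this deforms the Koszul complex on \<open>e\<^sub>0, e\<^sub>1, e\<^sub>2, e\<^sub>1\<^sub>2\<close> by adding the unit term
  \<open>e\<^sub>1\<^sub>2 \<mapsto> e\<^sub>0\<close>. The span of \<open>e\<^sub>1\<^sub>2\<close> and \<open>d e\<^sub>1\<^sub>2\<close> is then contractible, and the complement spanned by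
  \<open>e\<^sub>1 - x\<^sub>1 e\<^sub>1\<^sub>2\<close> and \<open>- (e\<^sub>2 - x\<^sub>2 e\<^sub>1\<^sub>2)\<close> is a copy of \<open>D\<^sub>2\<close>.\<close>

lemma flag_D_matrix:
  "2 \<le> n \<Longrightarrow> \<exists>es E P Q (s :: 'k::field mpoly mat). hmat n 2 es es E \<and> E * E = 0\<^sub>m (length es) (length es) \<and>
    (\<forall>i<length es. \<forall>j\<le>i. E $$ (i, j) = 0) \<and>
    hmat n 0 (D_twists c n) es P \<and> hmat n 0 es (D_twists c n) Q \<and> hmat n (- 2) es es s \<and>
    P * D_matrix n = E * P \<and> Q * E = D_matrix n * Q \<and> Q * P = 1\<^sub>m (length (D_twists c n)) \<and>
    E * s + s * E + P * Q = 1\<^sub>m (length es)"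
proof (induction n rule: nat_induct_at_least)
  case base
  have V: "(Var (Suc 0) :: 'k mpoly) \<in> Poly_deg 2 1" "(Var 2 :: 'k mpoly) \<in> Poly_deg 2 1" "(1 :: 'k mpoly) \<in> Poly_deg 2 0"
    by (auto intro: Poly_deg_Var Poly_deg_one)
  let ?x = "Var (Suc 0) :: 'k mpoly" and ?y = "Var 2 :: 'k mpoly"
  \<comment> \<open>The twists of e_0, e_1, e_2, e_12 grow with the exterior degree. For a
    differential of degree 2 the Koszul entries are then linear, and the entry from e_12 to e_0 has
    degree 2 + (c - 1) - (c + 1) = 0, which admits a unit.\<close>
  let ?es = "[c - 1, c, c, c + 1]"
  let ?E = "mat_of_rows_list 4 [[0, ?x, ?y, 1], [0, 0, 0, - ?y], [0, 0, 0, ?x], [0, 0, 0, 0]]"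
  let ?P = "mat_of_rows_list 2 [[0, 0], [1, 0], [0, - 1], [- ?x, ?y]]"
  \<comment> \<open>This projection kills e_12 and d e_12 = e_0 - x_2 e_1 + x_1 e_2. Hence e_0 goes
    to x_2 e_1 - x_1 e_2 modulo e_12, whose coordinates in the complement are (x_2, x_1).\<close>
  let ?Q = "mat_of_rows_list 4 [[?y, 1, 0, 0], [?x, 0, - 1, 0]]"
  \<comment> \<open>The homotopy contracts the pair e_12, d e_12 by sending e_0 back to
    e_12.\<close>
  let ?s = "mat_of_rows_list 4 [[0, 0, 0, 0], [0, 0, 0, 0], [0, 0, 0, 0], [1, 0, 0, 0]] :: 'k mpoly mat"
  have four: "i < Suc (Suc (Suc (Suc 0))) \<longleftrightarrow> i = 0 \<or> i = 1 \<or> i = 2 \<or> i = 3" for i :: nat by auto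
  have y: "Var (Suc (Suc 0)) = ?y" by (simp add: numeral_2_eq_2)
  have *: "hmat 2 2 ?es ?es ?E" "hmat 2 0 [c, c] ?es ?P" "hmat 2 0 ?es [c, c] ?Q" "hmat 2 (- 2) ?es ?es ?s"
    using V by (auto simp: hmat_def mat_of_rows_list_def four less_Suc_Suc_0_iff numeral_3_eq_3 intro!: Poly_deg_uminus)
  have "?E * ?E = 0\<^sub>m (length ?es) (length ?es)"
    by (rule eq_matI) (auto simp: small_mat_simps)
  moreover have "\<forall>i<length ?es. \<forall>j\<le>i. ?E $$ (i, j) = 0"
    by (auto simp: mat_of_rows_list_def four le_Suc_eq numeral_eq_Suc)
  moreover have "?P * D2_matrix = ?E * ?P" "?Q * ?E = D2_matrix * ?Q"
    by (rule eq_matI; auto simp: D2_matrix_def small_mat_simps)+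
  moreover have "?Q * ?P = 1\<^sub>m (length [c, c])"
    by (rule eq_matI) (auto simp: small_mat_simps)
  moreover have "?E * ?s + ?s * ?E + ?P * ?Q = 1\<^sub>m (length ?es)"
    by (rule eq_matI) (auto simp: small_mat_simps)
  ultimately show ?case
    unfolding D_matrix_2 D_twists_2 using * by blast
next
  case (Suc n)
  let ?ts = "D_twists c n" and ?D = "D_matrix n :: 'k mpoly mat" and ?x = "Var (Suc n) :: 'k mpoly"
  obtain es E P Q and s :: "'k mpoly mat" where E: "hmat n 2 es es E" "E * E = 0\<^sub>m (length es) (length es)"
      "\<forall>i<length es. \<forall>j\<le>i. E $$ (i, j) = 0"
    and P: "hmat n 0 ?ts es P" and Q: "hmat n 0 es ?ts Q" and s: "hmat n (- 2) es es s"
    and PD: "P * ?D = E * P" and QE: "Q * E = ?D * Q" and QP: "Q * P = 1\<^sub>m (length ?ts)"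
    and h: "E * s + s * E + P * Q = 1\<^sub>m (length es)"
    using Suc.IH by blast
  note DC = D_matrix_carrier[OF Suc.hyps, of c, where 'a = 'k]
  note C = hmat_carrier[OF E(1)] hmat_carrier[OF P] hmat_carrier[OF Q] hmat_carrier[OF s]
  let ?es = "es @ map (\<lambda>t. t + 1) es"
  let ?s = "four_block_mat (- s) (0\<^sub>m (length es) (length es)) (0\<^sub>m (length es) (length es)) s"
  have "hmat (Suc n) 2 ?es ?es (cone ?x E)" by (rule hmat_cone[OF E(1)])
  moreover have "cone ?x E * cone ?x E = 0\<^sub>m (length ?es) (length ?es)"
    using cone_square[OF C(1) E(2)] by simp
  \<comment> \<open>Triangularity survives: the diagonal blocks have it, the scalar block lies above
    them, and the block below is zero.\<close>
  moreover have "cone ?x E $$ (i, j) = 0" if "i < length ?es" "j \<le> i" for i j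
    using that E(3) C(1) by (auto simp: cone_def)
  moreover have "hmat (Suc n) 0 (D_twists c (Suc n)) ?es (dbl P)" "hmat (Suc n) 0 ?es (D_twists c (Suc n)) (dbl Q)"
    using hmat_blocks[OF P P] hmat_blocks[OF Q Q] C by (auto simp: dbl_def D_twists_Suc Suc.hyps)
  moreover have "hmat (Suc n) (- 2) ?es ?es ?s" by (rule hmat_blocks[OF hmat_uminus[OF s] s])
  moreover have "dbl P * D_matrix (Suc n) = cone ?x E * dbl P" "dbl Q * cone ?x E = D_matrix (Suc n) * dbl Q"
    unfolding D_matrix_Suc[OF Suc.hyps]
    by (rule dbl_cone[OF C(2) DC C(1) PD], rule dbl_cone[OF C(3) C(1) DC QE])
  moreover have "dbl Q * dbl P = 1\<^sub>m (length (D_twists c (Suc n)))"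
    using dbl_mult[OF C(3,2)] by (simp add: QP dbl_one D_twists_Suc Suc.hyps)
  moreover have "cone ?x E * ?s + ?s * cone ?x E + dbl P * dbl Q = 1\<^sub>m (length ?es)"
    using cone_homotopy[OF C(1,4) _ h] C by (simp add: dbl_mult[OF C(2,3)])
  ultimately show ?case by blast
qed


section \<open>The homology of \<open>D\<^sub>n\<close>\<close>

text \<open>The zeros appear because each cone contains this cycle in its first summand.\<close>

definition D_cycle :: "nat \<Rightarrow> 'k::field mpoly vec" where
  "D_cycle N = vec N (\<lambda>i. if i = 0 then Var 2 else if i = 1 then Var 1 else 0)"

lemma D_cycle_carrier [simp]: "D_cycle N \<in> carrier_vec N" "dim_vec (D_cycle N) = N"
  by (simp_all add: D_cycle_def)

lemma D_cycle_append: "2 \<le> N \<Longrightarrow> D_cycle (N + M) = D_cycle N @\<^sub>v 0\<^sub>v M"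
  by (rule eq_vecI) (auto simp: D_cycle_def)

text \<open>The matrix has rank one: it is the column (x_2, x_1) times the row (x_1, - x_2). So its
  kernel is that of the row, and its image is the ideal (x_1, x_2) times the column.\<close>

lemma D2_mult_vec:
  fixes v :: "'k::field mpoly vec"
  assumes "v \<in> carrier_vec 2"
  shows "(D2_matrix *\<^sub>v v) $ 0 = Var 2 * (Var 1 * v $ 0 - Var 2 * v $ 1)"
    and "(D2_matrix *\<^sub>v v) $ 1 = Var 1 * (Var 1 * v $ 0 - Var 2 * v $ 1)"
proof -
  have C: "(D2_matrix :: 'k mpoly mat) \<in> carrier_mat 2 2"
    using dim_D_matrix[of 2, where 'k = 'k] by (simp add: D_matrix_2)
  show "(D2_matrix *\<^sub>v v) $ 0 = Var 2 * (Var 1 * v $ 0 - Var 2 * v $ 1)"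
    and "(D2_matrix *\<^sub>v v) $ 1 = Var 1 * (Var 1 * v $ 0 - Var 2 * v $ 1)"
    by (subst index_mult_mat_vec_sum[OF C assms], simp,
        simp add: numeral_2_eq_2 D2_matrix_def mat_of_rows_list_def algebra_simps power2_eq_square)+
qed

lemma D_matrix_D_cycle: "2 \<le> n \<Longrightarrow> (D_matrix n :: 'k::field mpoly mat) *\<^sub>v D_cycle (2 ^ (n - 1)) = 0\<^sub>v (2 ^ (n - 1))"
proof (induction n rule: nat_induct_at_least)
  case base
  have "D_matrix 2 *\<^sub>v (D_cycle 2 :: 'k mpoly vec) = 0\<^sub>v 2"
  proof (rule eq_vecI)
    fix i assume "i < dim_vec (0\<^sub>v 2 :: 'k mpoly vec)"
    then have "i = 0 \<or> i = 1" by auto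
    then show "(D_matrix 2 *\<^sub>v (D_cycle 2 :: 'k mpoly vec)) $ i = 0\<^sub>v 2 $ i"
      unfolding D_matrix_2 using D2_mult_vec[of "D_cycle 2"] by (auto simp: D_cycle_def)
  qed (use dim_D_matrix[of 2, where 'k = 'k] in simp)
  then show ?case by simp
next
  case (Suc n)
  let ?N = "(2::nat) ^ (n - 1)"
  have e: "(2::nat) ^ (Suc n - 1) = ?N + ?N" and N: "2 \<le> ?N"
    using Suc.hyps self_le_power[of 2 "n - 1"] by (cases n; simp)+
  have "0\<^sub>v ?N \<in> carrier_vec ?N" by simp
  have "D_matrix n *\<^sub>v 0\<^sub>v ?N = (0\<^sub>v ?N :: 'k mpoly vec)"
    using dim_D_matrix[OF Suc.hyps, where 'k = 'k] by (intro eq_vecI) auto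
  then show ?case
    unfolding e D_cycle_append[OF N] D_matrix_Suc[OF Suc.hyps]
      cone_mult_vec[OF dim_D_matrix[OF Suc.hyps] D_cycle_carrier(1) zero_carrier_vec] Suc.IH
    by (intro eq_vecI) auto
qed

lemma free_monoms_Suc: "free_monoms (Suc n) = free_monoms n \<inter> {m. Poly_Mapping.lookup m (Suc n) = 0}"
  by (auto simp: free_monoms_def in_keys_iff atLeastAtMostSuc_conv)

lemma free_monoms_2: "free_monoms 2 = {m. Poly_Mapping.lookup m 1 = 0 \<and> Poly_Mapping.lookup m 2 = 0}"
proof -
  have "{1..2} = {1, 2::nat}" by auto
  then show ?thesis by (auto simp: free_monoms_def in_keys_iff)
qed

lemma free_monoms_mult: "p \<in> supported (free_monoms n) \<Longrightarrow> q \<in> supported (free_monoms n) \<Longrightarrow> p * q \<in> supported (free_monoms n)"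
  by (erule supported_mult) (auto simp: free_monoms_def keys_add_monom)

lemma Var_free_monoms: "n < i \<Longrightarrow> Var i \<in> supported (free_monoms n)"
  by (simp add: Var_supported free_monoms_def)

lemma mult_mat_vec_eq_comb:
  fixes A :: "'a::comm_ring_1 mat"
  assumes "A \<in> carrier_mat r r" "u \<in> carrier_vec r" "w \<in> carrier_vec r" "i < r"
  shows "(A *\<^sub>v (u + w)) $ i = (A *\<^sub>v u) $ i + (A *\<^sub>v w) $ i"
    and "(A *\<^sub>v (u - w)) $ i = (A *\<^sub>v u) $ i - (A *\<^sub>v w) $ i"
    and "(A *\<^sub>v (c \<cdot>\<^sub>v u)) $ i = c * (A *\<^sub>v u) $ i"
    and "(A *\<^sub>v - u) $ i = - (A *\<^sub>v u) $ i"
  using assms by (auto simp: scalar_prod_add_distrib[of _ r] scalar_prod_minus_distrib[of _ r])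

lemma split_vec:
  assumes "v \<in> carrier_vec (r + r)"
  obtains u w where "v = u @\<^sub>v w" "u \<in> carrier_vec r" "w \<in> carrier_vec r"
proof
  show "v = vec_first v r @\<^sub>v vec_last v r" using assms by simp
qed simp_all

text \<open>Over the polynomial ring in all variables the homology of the matrix of \<open>D\<^sub>n\<close> is the free module
  on the class of \<open>D_cycle\<close> over the polynomials in the variables other than \<open>x\<^sub>1,\<dots>,x\<^sub>n\<close>. This
  form is stable under the recursion, since the next variable acts injectively on that module.\<close>

lemma D_matrix_homology:
  assumes "2 \<le> n"
  shows "(\<forall>v \<in> carrier_vec (2 ^ (n - 1)). D_matrix n *\<^sub>v v = 0\<^sub>v (2 ^ (n - 1)) \<longrightarrow>
      (\<exists>y \<in> carrier_vec (2 ^ (n - 1)). \<exists>q \<in> supported (free_monoms n).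
        v = D_matrix n *\<^sub>v y + q \<cdot>\<^sub>v (D_cycle (2 ^ (n - 1)) :: 'k::field mpoly vec))) \<and>
    (\<forall>y \<in> carrier_vec (2 ^ (n - 1)). \<forall>q \<in> supported (free_monoms n).
      D_matrix n *\<^sub>v y = q \<cdot>\<^sub>v (D_cycle (2 ^ (n - 1)) :: 'k mpoly vec) \<longrightarrow> q = 0)"
  using assms
proof (induction n rule: nat_induct_at_least)
  case base
  let ?x = "Var 1 :: 'k mpoly" and ?y = "Var 2 :: 'k mpoly" and ?z = "D_cycle 2 :: 'k mpoly vec"
  have e: "(2::nat) ^ (2 - 1) = 2" by simp
  have dim: "dim_row (D2_matrix :: 'k mpoly mat) = 2"
    using dim_D_matrix[of 2, where 'k = 'k] by (simp add: D_matrix_2)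
  have ev: "v = w \<longleftrightarrow> v $ 0 = w $ 0 \<and> v $ 1 = w $ 1" if "dim_vec v = 2" "dim_vec w = 2" for v w :: "'k mpoly vec"
    using that by (auto simp: less_2_cases_iff)
  show ?case
    unfolding e D_matrix_2
  proof (intro conjI ballI impI)
    fix v :: "'k mpoly vec" assume v: "v \<in> carrier_vec 2" and "D2_matrix *\<^sub>v v = 0\<^sub>v 2"
    then have "?y * (?x * v $ 0 - ?y * v $ 1) = 0"
      using D2_mult_vec(1)[OF v] by simp
    then have xy: "?x * v $ 0 = ?y * v $ 1" by simp
    let ?T = "{m. Poly_Mapping.lookup m 2 = 0} :: (nat \<Rightarrow>\<^sub>0 nat) set"
    \<comment> \<open>The remainder of v_0 modulo x_2, multiplied by x_1, is a multiple of x_2 free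
      of x_2, hence zero. So v is r times the cycle.\<close>
    obtain r where r: "v $ 0 = restr ?T (v $ 0) + ?y * r" using split_off_variable by blast
    have "?x * restr ?T (v $ 0) = ?y * (v $ 1 - ?x * r)"
      using xy r by (metis (no_types, lifting) add_diff_cancel_right' mult.left_commute right_diff_distrib)
    moreover have "?x * restr ?T (v $ 0) \<in> supported ?T"
      by (rule supported_mult[where A = ?T and B = ?T]) (auto simp: Var_supported lookup_add lookup_single)
    ultimately have "?y * (v $ 1 - ?x * r) = 0"
      by (intro Var_mult_supported_imp_0) simp
    then have v1: "v $ 1 = ?x * r" by simp
    then have "?x * v $ 0 = ?x * (?y * r)" using xy by (simp add: mult.left_commute)
    then have v0: "v $ 0 = ?y * r" by simp
    \<comment> \<open>Reducing \<open>r\<close> by x_1 and then by x_2 separates a coefficient in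
      the other variables from an element of the ideal (x_1, x_2), which accounts for a
      boundary.\<close>
    obtain p1 where p1: "r = restr {m. Poly_Mapping.lookup m 1 = 0} r + ?x * p1"
      using split_off_variable by blast
    let ?r = "restr {m. Poly_Mapping.lookup m 1 = 0} r"
    obtain p2 where p2: "?r = restr ?T ?r + ?y * p2"
      using split_off_variable by blast
    \<comment> \<open>The row (x_1, - x_2) sends this vector to x_1 p1 + x_2 p2.\<close>
    let ?Y = "vec_of_list [p1, - p2]"
    have "restr ?T ?r \<in> supported (free_monoms 2)"
      by (auto simp: supported_def keys_restr free_monoms_2)
    moreover have "r = restr ?T ?r + ?x * p1 + ?y * p2" using p1 p2 by (simp add: algebra_simps)
    ultimately obtain q where q: "q \<in> supported (free_monoms 2)" and r: "r = q + ?x * p1 + ?y * p2"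
      by blast
    have Y: "?Y \<in> carrier_vec 2" by (simp add: carrier_vecI)
    have "v = D2_matrix *\<^sub>v ?Y + q \<cdot>\<^sub>v ?z"
      using v dim D2_mult_vec[OF Y] v0 v1
      by (subst ev) (auto simp: D_cycle_def r algebra_simps simp del: index_mult_mat_vec)
    then show "\<exists>y\<in>carrier_vec 2. \<exists>q\<in>supported (free_monoms 2). v = D2_matrix *\<^sub>v y + q \<cdot>\<^sub>v ?z"
      using Y q by blast
  next
    fix y :: "'k mpoly vec" and q :: "'k mpoly"
    assume y: "y \<in> carrier_vec 2" and q: "q \<in> supported (free_monoms 2)" and eq: "D2_matrix *\<^sub>v y = q \<cdot>\<^sub>v ?z"
    have "?y * (?x * y $ 0 - ?y * y $ 1) = (q \<cdot>\<^sub>v ?z) $ 0"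
      using D2_mult_vec(1)[OF y] eq by simp
    also have "\<dots> = ?y * q" by (simp add: D_cycle_def)
    finally have "?x * y $ 0 - ?y * y $ 1 = q" by (simp only: mult_cancel_left Var_neq_0 simp_thms)
    then have "?x * y $ 0 = q + ?y * y $ 1" by (simp add: algebra_simps)
    \<comment> \<open>Multiples of x_1 or x_2 have no monomial free of both, so restricting the
      equation to such monomials leaves only q, which is therefore zero.\<close>
    moreover have "restr (free_monoms 2) (Var i * p) = 0" if "i = 1 \<or> i = 2" for i and p :: "'k mpoly"
    proof (rule restr_eq_0)
      show "Var i * p \<in> supported {m. Poly_Mapping.lookup m i \<noteq> 0}"
        by (rule supported_mult[where A = "{Poly_Mapping.single i 1}" and B = UNIV])
          (auto simp: Var_supported lookup_add)
      show "{m. Poly_Mapping.lookup m i \<noteq> 0} \<inter> free_monoms 2 = {}"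
        using that by (auto simp: free_monoms_2)
    qed
    ultimately have "restr (free_monoms 2) q = 0"
      by (metis restr_add add.right_neutral)
    then show "q = 0" using restr_ident[OF q] by simp
  qed
next
  case (Suc n)
  let ?N = "(2::nat) ^ (n - 1)" and ?D = "D_matrix n :: 'k mpoly mat" and ?x = "Var (Suc n) :: 'k mpoly"
  let ?z = "D_cycle ?N :: 'k mpoly vec"
  have e: "(2::nat) ^ (Suc n - 1) = ?N + ?N" and N: "2 \<le> ?N"
    using Suc.hyps self_le_power[of 2 "n - 1"] by (cases n; simp)+
  note D = dim_D_matrix[OF Suc.hyps, where 'k = 'k]
  note comb = mult_mat_vec_eq_comb[OF D]
  have Dz: "?D *\<^sub>v ?z = 0\<^sub>v ?N" by (rule D_matrix_D_cycle[OF Suc.hyps])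
  have Dzi: "(?D *\<^sub>v ?z) $ i = 0" if "i < ?N" for i using that by (simp only: Dz index_zero_vec)
  have DC: "?D *\<^sub>v u \<in> carrier_vec ?N" if "u \<in> carrier_vec ?N" for u
    using D that by (rule mult_mat_vec_carrier)
  have DD: "?D *\<^sub>v (?D *\<^sub>v u) = 0\<^sub>v ?N" if "u \<in> carrier_vec ?N" for u
  proof -
    have "?D *\<^sub>v (?D *\<^sub>v u) = (?D * ?D) *\<^sub>v u" using assoc_mult_mat_vec[OF D D that] by simp
    also have "\<dots> = 0\<^sub>v ?N" unfolding D_matrix_square[OF Suc.hyps] using that by (intro eq_vecI) auto
    finally show ?thesis .
  qed
  have DDi: "(?D *\<^sub>v (?D *\<^sub>v u)) $ i = 0" if "u \<in> carrier_vec ?N" "i < ?N" for u i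
    using that by (simp only: DD index_zero_vec)
  have ex: "\<exists>y\<in>carrier_vec ?N. \<exists>q\<in>supported (free_monoms n). v = ?D *\<^sub>v y + q \<cdot>\<^sub>v ?z"
    if "v \<in> carrier_vec ?N" "?D *\<^sub>v v = 0\<^sub>v ?N" for v
    using Suc.IH that by blast
  have uniq: "q = 0" if "y \<in> carrier_vec ?N" "q \<in> supported (free_monoms n)" "?D *\<^sub>v y = q \<cdot>\<^sub>v ?z" for y q
    using Suc.IH that by blast
  show ?case
    unfolding e D_matrix_Suc[OF Suc.hyps]
  proof (intro conjI ballI impI)
    fix v :: "'k mpoly vec" assume v: "v \<in> carrier_vec (?N + ?N)" and Cv: "cone ?x ?D *\<^sub>v v = 0\<^sub>v (?N + ?N)"
    obtain u w where vuw: "v = u @\<^sub>v w" and u: "u \<in> carrier_vec ?N" and w: "w \<in> carrier_vec ?N"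
      using split_vec[OF v] .
    have "0\<^sub>v (?N + ?N) = 0\<^sub>v ?N @\<^sub>v (0\<^sub>v ?N :: 'k mpoly vec)" by (rule eq_vecI) auto
    then have "(?x \<cdot>\<^sub>v w - ?D *\<^sub>v u) @\<^sub>v (?D *\<^sub>v w) = 0\<^sub>v ?N @\<^sub>v 0\<^sub>v ?N"
      using Cv unfolding vuw cone_mult_vec[OF D u w] by simp
    then have xw: "?x \<cdot>\<^sub>v w - ?D *\<^sub>v u = 0\<^sub>v ?N" and Dw: "?D *\<^sub>v w = 0\<^sub>v ?N"
      by (simp_all only: append_vec_eq[OF minus_carrier_vec[OF smult_carrier_vec[THEN iffD2, OF w] DC[OF u]] zero_carrier_vec])
    have xwi: "?x * w $ i = (?D *\<^sub>v u) $ i" if "i < ?N" for i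
      using arg_cong[OF xw, of "\<lambda>v. v $ i"] that w D DC[OF u] by simp
    obtain y a where y: "y \<in> carrier_vec ?N" and a: "a \<in> supported (free_monoms n)" and wy: "w = ?D *\<^sub>v y + a \<cdot>\<^sub>v ?z"
      using ex[OF w Dw] by blast
    have wyi: "w $ i = (?D *\<^sub>v y) $ i + a * ?z $ i" if "i < ?N" for i
      using that D DC[OF y] by (simp add: wy)
    \<comment> \<open>With x the new variable, x w = D u and w = D y + a z show that x a z is a
      boundary before taking the cone. Uniqueness there gives x a = 0, so x acts injectively on
      homology.\<close>
    have "?D *\<^sub>v (u - ?x \<cdot>\<^sub>v y) = (?x * a) \<cdot>\<^sub>v ?z"
    proof (rule eq_vecI)
      fix i assume "i < dim_vec ((?x * a) \<cdot>\<^sub>v ?z)"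
      then have i: "i < ?N" by simp
      have "(?D *\<^sub>v (u - ?x \<cdot>\<^sub>v y)) $ i = ?x * w $ i - ?x * (?D *\<^sub>v y) $ i"
        using i u y by (simp only: comb smult_carrier_vec xwi)
      also have "\<dots> = ((?x * a) \<cdot>\<^sub>v ?z) $ i"
        using i by (simp add: wyi algebra_simps)
      finally show "(?D *\<^sub>v (u - ?x \<cdot>\<^sub>v y)) $ i = ((?x * a) \<cdot>\<^sub>v ?z) $ i" .
    qed (use D in simp)
    then have "?x * a = 0"
      using u y a by (intro uniq[of "u - ?x \<cdot>\<^sub>v y"] free_monoms_mult Var_free_monoms) auto
    then have "a = 0" by simp
    moreover have "0 \<cdot>\<^sub>v ?z = 0\<^sub>v ?N" by (rule eq_vecI) auto
    ultimately have wy': "w = ?D *\<^sub>v y" and *: "?D *\<^sub>v (u - ?x \<cdot>\<^sub>v y) = 0\<^sub>v ?N"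
      using \<open>?D *\<^sub>v (u - ?x \<cdot>\<^sub>v y) = (?x * a) \<cdot>\<^sub>v ?z\<close> wy DC[OF y] by auto
    obtain y' b where y': "y' \<in> carrier_vec ?N" and b: "b \<in> supported (free_monoms n)"
      and uy: "u - ?x \<cdot>\<^sub>v y = ?D *\<^sub>v y' + b \<cdot>\<^sub>v ?z"
      using ex[OF _ *] u y by auto
    let ?b0 = "restr {m. Poly_Mapping.lookup m (Suc n) = 0} b"
    \<comment> \<open>In the cone x b' z is the boundary of (0, b' z), so only the part of
      \<open>b\<close> free of the new variable survives.\<close>
    obtain b' where b': "b = ?b0 + ?x * b'" using split_off_variable by blast
    have b0: "?b0 \<in> supported (free_monoms (Suc n))"
      using b by (auto simp: supported_def keys_restr free_monoms_Suc)
    \<comment> \<open>The second half of the preimage. The first half is - y', whose sign undoes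
      that of the block - D.\<close>
    let ?w = "y + b' \<cdot>\<^sub>v ?z"
    have w': "?w \<in> carrier_vec ?N" and y'': "- y' \<in> carrier_vec ?N" using y y' by auto
    have ui: "u $ i = ?x * y $ i + (?D *\<^sub>v y') $ i + (?b0 + ?x * b') * ?z $ i" if "i < ?N" for i
    proof -
      have "u $ i - ?x * y $ i = (?D *\<^sub>v y') $ i + b * ?z $ i"
        using arg_cong[OF uy, of "\<lambda>v. v $ i"] that u y D DC[OF y'] by simp
      then show ?thesis using b' by (simp add: algebra_simps)
    qed
    have "v = cone ?x ?D *\<^sub>v (- y' @\<^sub>v ?w) + ?b0 \<cdot>\<^sub>v (?z @\<^sub>v 0\<^sub>v ?N)"
      unfolding vuw cone_mult_vec[OF D y'' w']
    proof (rule eq_vecI)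
      fix i assume "i < dim_vec (((?x \<cdot>\<^sub>v ?w - ?D *\<^sub>v - y') @\<^sub>v (?D *\<^sub>v ?w)) + ?b0 \<cdot>\<^sub>v (?z @\<^sub>v 0\<^sub>v ?N))"
      then have i: "i < ?N + ?N" by simp
      show "(u @\<^sub>v w) $ i = (((?x \<cdot>\<^sub>v ?w - ?D *\<^sub>v - y') @\<^sub>v (?D *\<^sub>v ?w)) + ?b0 \<cdot>\<^sub>v (?z @\<^sub>v 0\<^sub>v ?N)) $ i"
      proof (cases "i < ?N")
        case True
        have "(?D *\<^sub>v - y') $ i = - (?D *\<^sub>v y') $ i" using comb(4)[OF y' y' True] .
        then show ?thesis
          using True u w y y' D DC[OF y''] DC[OF w'] ui[OF True]
          by (simp add: algebra_simps del: index_mult_mat_vec)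
      next
        case False
        then have j: "i - ?N < ?N" using i by simp
        have "(?D *\<^sub>v ?w) $ (i - ?N) = (?D *\<^sub>v y) $ (i - ?N)"
          using y j comb(1,3) by (simp only: comb Dzi D_cycle_carrier smult_carrier_vec) simp
        then show ?thesis
          using False i j u w y y' D DC[OF y''] DC[OF w'] wy'
          by (simp del: index_mult_mat_vec)
      qed
    qed (use u w y y' D in auto)
    then show "\<exists>y\<in>carrier_vec (?N + ?N). \<exists>q\<in>supported (free_monoms (Suc n)).
        v = cone ?x ?D *\<^sub>v y + q \<cdot>\<^sub>v D_cycle (?N + ?N)"
      unfolding D_cycle_append[OF N] using b0 append_carrier_vec[OF y'' w'] by blast
  next
    fix y :: "'k mpoly vec" and q :: "'k mpoly"
    assume y: "y \<in> carrier_vec (?N + ?N)" and q: "q \<in> supported (free_monoms (Suc n))"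
      and eq: "cone ?x ?D *\<^sub>v y = q \<cdot>\<^sub>v D_cycle (?N + ?N)"
    obtain u w where yuw: "y = u @\<^sub>v w" and u: "u \<in> carrier_vec ?N" and w: "w \<in> carrier_vec ?N"
      using split_vec[OF y] .
    have "q \<cdot>\<^sub>v (?z @\<^sub>v 0\<^sub>v ?N) = (q \<cdot>\<^sub>v ?z) @\<^sub>v 0\<^sub>v ?N" by (rule eq_vecI) auto
    then have "(?x \<cdot>\<^sub>v w - ?D *\<^sub>v u) @\<^sub>v (?D *\<^sub>v w) = (q \<cdot>\<^sub>v ?z) @\<^sub>v 0\<^sub>v ?N"
      using eq unfolding yuw cone_mult_vec[OF D u w] D_cycle_append[OF N] by simp
    then have xw: "?x \<cdot>\<^sub>v w - ?D *\<^sub>v u = q \<cdot>\<^sub>v ?z" and Dw: "?D *\<^sub>v w = 0\<^sub>v ?N"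
      by (simp_all only: append_vec_eq[OF minus_carrier_vec[OF smult_carrier_vec[THEN iffD2, OF w] DC[OF u]] smult_carrier_vec[THEN iffD2, OF D_cycle_carrier(1)]])
    have xwi: "?x * w $ i - (?D *\<^sub>v u) $ i = q * ?z $ i" if "i < ?N" for i
      using arg_cong[OF xw, of "\<lambda>v. v $ i"] that w D DC[OF u] by simp
    obtain y' a where y': "y' \<in> carrier_vec ?N" and a: "a \<in> supported (free_monoms n)" and wy: "w = ?D *\<^sub>v y' + a \<cdot>\<^sub>v ?z"
      using ex[OF w Dw] by blast
    have wyi: "w $ i = (?D *\<^sub>v y') $ i + a * ?z $ i" if "i < ?N" for i
      using that D DC[OF y'] by (simp add: wy)
    \<comment> \<open>Substituting w = D y' + a z into x w - D u = q z makes (q - x a) z a boundary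
      before taking the cone. Hence q = x a, and q is zero because it is free of x.\<close>
    have "?D *\<^sub>v (?x \<cdot>\<^sub>v y' - u) = (q - ?x * a) \<cdot>\<^sub>v ?z"
    proof (rule eq_vecI)
      fix i assume "i < dim_vec ((q - ?x * a) \<cdot>\<^sub>v ?z)"
      then have i: "i < ?N" by simp
      have "(?D *\<^sub>v (?x \<cdot>\<^sub>v y' - u)) $ i = ?x * (?D *\<^sub>v y') $ i - (?D *\<^sub>v u) $ i"
        using i u y' by (simp only: comb smult_carrier_vec)
      also have "\<dots> = ?x * w $ i - (?D *\<^sub>v u) $ i - ?x * a * ?z $ i"
        by (simp add: wyi[OF i] algebra_simps del: index_mult_mat_vec)
      also have "\<dots> = ((q - ?x * a) \<cdot>\<^sub>v ?z) $ i"
        using i xwi[OF i] by (simp add: algebra_simps)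
      finally show "(?D *\<^sub>v (?x \<cdot>\<^sub>v y' - u)) $ i = ((q - ?x * a) \<cdot>\<^sub>v ?z) $ i" .
    qed (use D in simp)
    moreover have "q - ?x * a \<in> supported (free_monoms n)"
      using q a by (intro supported_diff free_monoms_mult Var_free_monoms)
        (auto simp: free_monoms_Suc elim: supported_mono)
    ultimately have "q - ?x * a = 0"
      using u y' by (intro uniq[of "?x \<cdot>\<^sub>v y' - u"]) auto
    then have "q = ?x * a" by simp
    moreover have "q \<in> supported {m. Poly_Mapping.lookup m (Suc n) = 0}"
      using q by (auto simp: free_monoms_Suc elim: supported_mono)
    ultimately show "q = 0" using Var_mult_supported_imp_0 by blast
  qed
qed

text \<open>The monomial x_i factors only as 1 times x_i, so \<open>p\<close> would have to
  contribute one of these two. Applied to the entries of row 0, this shows that boundaries have no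
  x_2 term in their first coordinate.\<close>

lemma lookup_mult_degree_1:
  fixes p q :: "'k::field mpoly"
  assumes "Poly_Mapping.lookup p 0 = 0" "Poly_Mapping.lookup p (Poly_Mapping.single i 1) = 0"
  shows "Poly_Mapping.lookup (p * q) (Poly_Mapping.single i 1) = 0"
proof (rule lookup_not_supported[OF supported_mult[OF _ supported_UNIV]])
  show "p \<in> supported (- {0, Poly_Mapping.single i 1})"
    using assms by (auto simp: supported_def in_keys_iff)
  fix a b :: "nat \<Rightarrow>\<^sub>0 nat" assume "a \<in> - {0, Poly_Mapping.single i 1}"
  show "a + b \<in> - {Poly_Mapping.single i 1}"
  proof (rule ccontr)
    assume "\<not> ?thesis"
    then have "a + b = Poly_Mapping.single i 1" by simp
    from arg_cong[OF this, of "\<lambda>m. Poly_Mapping.lookup m _"]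
    have ab: "Poly_Mapping.lookup a j + Poly_Mapping.lookup b j = (if i = j then 1 else 0)" for j
      by (simp add: lookup_add lookup_single when_def)
    have "a = Poly_Mapping.single i (Poly_Mapping.lookup a i)"
    proof (rule poly_mapping_eqI)
      fix j show "Poly_Mapping.lookup a j = Poly_Mapping.lookup (Poly_Mapping.single i (Poly_Mapping.lookup a i)) j"
        using ab[of j] by (auto simp: lookup_single when_def)
    qed
    moreover have "Poly_Mapping.lookup a i = 0 \<or> Poly_Mapping.lookup a i = 1" using ab[of i] by auto
    ultimately have "a = Poly_Mapping.single i 0 \<or> a = Poly_Mapping.single i 1" by auto
    then show False using \<open>a \<in> _\<close> by auto
  qed
qed simp

lemma lookup_Var_mult: "Poly_Mapping.lookup (Var i * p) (Poly_Mapping.single i 1) = const_coeff p"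
proof -
  have p: "p = Poly_Mapping.single 0 (const_coeff p) + restr (- {0}) p"
    by (rule poly_mapping_eqI) (auto simp: lookup_restr lookup_add lookup_single const_coeff_def when_def)
  have "Var i * p = Var i * Poly_Mapping.single 0 (const_coeff p) + Var i * restr (- {0}) p"
    by (subst p) (rule distrib_left)
  moreover have "Poly_Mapping.lookup (Var i * restr (- {0}) p) (Poly_Mapping.single i 1) = 0"
    by (rule lookup_not_supported[OF supported_mult[where C = "- {Poly_Mapping.single i 1}"
            and A = "{Poly_Mapping.single i 1}", OF _ restr_supported]])
      (auto simp: Var_supported)
  ultimately show ?thesis by (simp add: lookup_add Var_def mult_single)
qed

text \<open>The entries for n = 2 are quadratic, and each cone adds to row 0 only zeros and its new
  variable, whose index is at least 3. This is what lets the coefficient of x_2 distinguish the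
  cycle from boundaries.\<close>

lemma D_matrix_row_0:
  "2 \<le> n \<Longrightarrow> j < 2 ^ (n - 1) \<Longrightarrow>
    Poly_Mapping.lookup ((D_matrix n :: 'k::field mpoly mat) $$ (0, j)) (Poly_Mapping.single 2 1) = 0"
proof (induction n arbitrary: j rule: nat_induct_at_least)
  case base
  have "Poly_Mapping.lookup (Var i * Var 2 :: 'k mpoly) (Poly_Mapping.single 2 1) = 0" for i
    using lookup_Var_mult[of 2 "Var i :: 'k mpoly"]
    by (simp add: mult.commute const_coeff_def Var_def lookup_single when_def flip: keys_eq_empty)
  then show ?case using base
    by (auto simp: D_matrix_2 D2_matrix_def mat_of_rows_list_def less_2_cases_iff power2_eq_square)
next
  case (Suc n)
  have e: "(2::nat) ^ (Suc n - 1) = 2 ^ (n - 1) + 2 ^ (n - 1)"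
    using Suc.hyps by (cases n) auto
  have "Poly_Mapping.lookup (Var (Suc n) :: 'k mpoly) (Poly_Mapping.single 2 1) = 0"
    using Suc.hyps by (auto simp: Var_def lookup_single when_def dest!: arg_cong[of _ _ Poly_Mapping.keys])
  then show ?case
    using Suc.prems Suc.IH dim_D_matrix[OF Suc.hyps, where 'k = 'k] unfolding e
    by (auto simp: D_matrix_Suc Suc.hyps cone_def)
qed

lemma D_twists_nth: "2 \<le> n \<Longrightarrow> D_twists c n ! 0 = c \<and> D_twists c n ! 1 = c"
proof (induction n rule: nat_induct_at_least)
  case base
  then show ?case by (simp add: D_twists_2)
next
  case (Suc n)
  have "2 \<le> length (D_twists c n)"
    using Suc.hyps self_le_power[of 2 "n - 1"] by (simp add: length_D_twists)
  then have "0 < length (D_twists c n)" "1 < length (D_twists c n)" by linarith+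
  then show ?case using Suc.IH by (simp add: D_twists_Suc Suc.hyps nth_append del: length_greater_0_conv)
qed

lemma diff_module_Dn: "2 \<le> n \<Longrightarrow> diff_module n 2 (Dn c n)"
  unfolding Dn_def by (rule diff_module_matrix_dmod[OF hmat_D_matrix]) (simp_all add: D_matrix_square length_D_twists)

text \<open>That the cycle generates is known over the ring in all variables. Restriction to the
  monomials in x_1,...,x_n is linear over k[x_1,...,x_n] and carries this over; it reduces the
  coefficient in the other variables to its constant term.\<close>

lemma homology_Dn:
  assumes n: "2 \<le> n"
  shows "graded_isomorphic n (homology (Dn c n :: ('k::field mpoly, 'k mpoly vec) dmod)) (twist (c - 1) residue_field)"
proof -
  let ?M = "Dn c n :: ('k mpoly, 'k mpoly vec) dmod" and ?D = "D_matrix n :: 'k mpoly mat"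
  let ?N = "(2::nat) ^ (n - 1)" and ?e = "Poly_Mapping.single 2 1 :: nat \<Rightarrow>\<^sub>0 nat"
  \<comment> \<open>\<open>?l\<close> is the coefficient of x_2 in the first coordinate, the
    coordinate in which the cycle has the entry x_2.\<close>
  let ?z = "D_cycle ?N :: 'k mpoly vec" and ?l = "\<lambda>v :: 'k mpoly vec. Poly_Mapping.lookup (v $ 0) ?e"
  note D = dim_D_matrix[OF n, where 'k = 'k]
  have N: "0 < ?N" by simp
  have M: "carrier ?M = vec_supp ?N (\<lambda>_. monoms n)" "add ?M = (+)" "zero ?M = 0\<^sub>v ?N" "smult ?M = (\<cdot>\<^sub>v)"
    "differential ?M = (\<lambda>v. ?D *\<^sub>v v)"
    by (simp_all add: Dn_def carrier_matrix_dmod length_D_twists[OF n])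
  have Mdeg: "deg_part ?M j = {v \<in> carrier_vec ?N. \<forall>i<?N. v $ i \<in> Poly_deg n (j + D_twists c n ! i)}" for j
    by (simp add: Dn_def matrix_dmod_def length_D_twists[OF n])
  interpret differential_module n 2 ?M
    by unfold_locales (rule diff_module_Dn[OF n])
  have Var: "Var 2 \<in> (Poly_deg n 1 :: 'k mpoly set)" "Var (Suc 0) \<in> (Poly_deg n 1 :: 'k mpoly set)"
    using n by (auto intro: Poly_deg_Var)
  have zM: "?z \<in> carrier ?M"
    using Var by (auto simp: M vec_supp_def D_cycle_def simp flip: carrier_Poly_Ring intro: Poly_deg_carrier Poly_Ring_zero)
  have span: "\<exists>a. \<exists>b\<in>boundaries ?M. x = b \<oplus>\<^bsub>?M\<^esub> Poly_Mapping.single 0 a \<odot>\<^bsub>?M\<^esub> ?z"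
    if x: "x \<in> cycles ?M" for x
  proof -
    have xC: "x \<in> carrier_vec ?N" and xs: "\<And>i. i < ?N \<Longrightarrow> x $ i \<in> supported (monoms n)" and "?D *\<^sub>v x = 0\<^sub>v ?N"
      using x by (auto simp: cycles_def M vec_supp_def)
    then obtain y q where y: "y \<in> carrier_vec ?N" and q: "q \<in> supported (free_monoms n)"
      and xy: "x = ?D *\<^sub>v y + q \<cdot>\<^sub>v ?z"
      using D_matrix_homology[OF n, where 'k = 'k] by blast
    let ?y = "map_vec (restr (monoms n)) y" and ?a = "Poly_Mapping.lookup q 0"
    have yC: "?y \<in> carrier_vec ?N" using y by simp
    have yM: "?y \<in> carrier ?M" using y by (auto simp: M vec_supp_def)
    have r: "restr (monoms n) (p * p') = p * restr (monoms n) p'" if "p \<in> carrier (Poly_Ring n)" for p p' :: "'k mpoly"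
      using that by (intro restr_mult) (auto simp: carrier_Poly_Ring add_monoms)
    have "m = 0" if "m \<in> monoms n" "m \<in> free_monoms n" for m
      using that by (auto simp: monoms_def free_monoms_def simp flip: keys_eq_empty)
    then have rq: "restr (monoms n) q = Poly_Mapping.single 0 ?a"
      using q by (intro poly_mapping_eqI) (auto simp: lookup_restr lookup_single when_def intro: lookup_not_supported)
    have "x = ?D *\<^sub>v ?y + Poly_Mapping.single 0 ?a \<cdot>\<^sub>v ?z"
    proof (rule eq_vecI)
      fix i assume "i < dim_vec (?D *\<^sub>v ?y + Poly_Mapping.single 0 ?a \<cdot>\<^sub>v ?z)"
      then have i: "i < ?N" by simp
      have Dij: "?D $$ (i, j) \<in> carrier (Poly_Ring n)" if "j < ?N" for j
        using D_matrix_max_ideal[OF n i that, where 'k = 'k] by (simp add: max_ideal_def)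
      have zi: "?z $ i \<in> carrier (Poly_Ring n)"
        using vec_suppD(3)[OF zM[unfolded M(1)] i] by (simp only: carrier_Poly_Ring)
      have "x $ i = (\<Sum>j<?N. ?D $$ (i, j) * y $ j) + ?z $ i * q"
        using i mult_mat_vec_carrier[OF D y] unfolding xy
        by (simp add: index_mult_mat_vec_sum[OF D y] mult.commute del: index_mult_mat_vec)
      then have "restr (monoms n) (x $ i) = (\<Sum>j<?N. ?D $$ (i, j) * restr (monoms n) (y $ j)) + ?z $ i * Poly_Mapping.single 0 ?a"
        using Dij zi by (simp add: restr_add restr_sum r rq)
      also have "\<dots> = (?D *\<^sub>v ?y + Poly_Mapping.single 0 ?a \<cdot>\<^sub>v ?z) $ i"
        using i y mult_mat_vec_carrier[OF D yC]
        by (simp add: index_mult_mat_vec_sum[OF D yC] mult.commute del: index_mult_mat_vec)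
      finally show "x $ i = (?D *\<^sub>v ?y + Poly_Mapping.single 0 ?a \<cdot>\<^sub>v ?z) $ i"
        using restr_ident[OF xs[OF i]] by simp
    qed (use xC in simp)
    moreover have "?D *\<^sub>v ?y \<in> boundaries ?M" using yM by (auto simp: boundaries_def M)
    ultimately show ?thesis by (auto simp: M)
  qed
  have "graded_isomorphic n (homology ?M) (twist (c - 1) residue_field)"
  proof (rule homology_residue_field[where z = ?z and l = ?l])
    show "?z \<in> cycles ?M" using zM D_matrix_D_cycle[OF n, where 'k = 'k] by (simp add: cycles_def M)
    \<comment> \<open>The entries are linear and lie in copies of S(c), so the degree is 1 -
      c.\<close>
    show "?z \<in> deg_part ?M (- (c - 1))"
      using Var D_twists_nth[OF n, of c] by (auto simp: Mdeg D_cycle_def)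
    show "\<exists>a. \<exists>b\<in>boundaries ?M. x = b \<oplus>\<^bsub>?M\<^esub> Poly_Mapping.single 0 a \<odot>\<^bsub>?M\<^esub> ?z"
      if "x \<in> cycles ?M" for x using that by (rule span)
    show "?l (x \<oplus>\<^bsub>?M\<^esub> y) = ?l x + ?l y" if "x \<in> carrier ?M" "y \<in> carrier ?M" for x y
      using that N by (simp add: M lookup_add vec_suppD)
    show "?l b = 0" if b: "b \<in> boundaries ?M" for b
    proof -
      obtain y where y: "y \<in> carrier_vec ?N" "b = ?D *\<^sub>v y"
        using b by (auto simp: boundaries_def M dest: vec_suppD(2))
      have "Poly_Mapping.lookup (?D $$ (0, j) * y $ j) ?e = 0" if "j < ?N" for j
        using D_matrix_row_0[OF n that, where 'k = 'k] D_matrix_max_ideal[OF n N that, where 'k = 'k]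
        by (intro lookup_mult_degree_1) (auto simp: max_ideal_def const_coeff_def)
      then show ?thesis
        unfolding y(2) index_mult_mat_vec_sum[OF D y(1) N] by (simp add: lookup_sum)
    qed
    show "?l (r \<odot>\<^bsub>?M\<^esub> ?z) = const_coeff r" if "r \<in> carrier (Poly_Ring n)" for r
      using lookup_Var_mult[of 2 r] by (simp add: M D_cycle_def mult.commute)
    \<comment> \<open>A first coordinate of degree j + c contains the monomial x_2 only if j + c =
      1.\<close>
    show "?l x = 0" if "x \<in> deg_part ?M j" "j \<noteq> - (c - 1)" for j x
    proof -
      have "x $ 0 \<in> Poly_deg n (j + D_twists c n ! 0)" using that(1) N by (simp only: Mdeg mem_Collect_eq)
      then have "x $ 0 \<in> Poly_deg n (j + c)" using D_twists_nth[OF n, of c] by simp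
      then show ?thesis
        unfolding Poly_deg_eq by (rule lookup_not_supported) (use that(2) in auto)
    qed
  qed
  then show ?thesis .
qed

theorem corollary3p10:
  fixes c :: int and n :: nat
  assumes "n \<ge> 2"
  shows "\<exists>(N :: ('k::field mpoly, 'k mpoly vec) dmod) \<phi>.
           minimal_free_resolution TYPE('k mpoly vec) n 2 (Dn c n) N \<phi> \<and>
           graded_isomorphic n (homology N) (twist (c - 1) residue_field)"
proof (intro exI conjI)
  let ?M = "Dn c n :: ('k mpoly, 'k mpoly vec) dmod" and ?ts = "D_twists c n" and ?D = "D_matrix n :: 'k mpoly mat"
  show "graded_isomorphic n (homology ?M) (twist (c - 1) residue_field)"
    using assms by (rule homology_Dn)
  have len: "length ?ts = 2 ^ (n - 1)" using assms by (rule length_D_twists)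
  have hD: "hmat n 2 ?ts ?ts ?D" and DD: "?D * ?D = 0\<^sub>m (length ?ts) (length ?ts)"
    using hmat_D_matrix[OF assms] D_matrix_square[OF assms] len by auto
  have minimal: "minimal n 2 ?M"
    unfolding Dn_def using hD DD D_matrix_max_ideal[OF assms] len by (intro minimal_matrix_dmod) auto
  have M: "diff_module n 2 ?M" using assms by (rule diff_module_Dn)
  obtain es E P Q and s :: "'k mpoly mat" where E: "hmat n 2 es es E" "E * E = 0\<^sub>m (length es) (length es)"
      "\<forall>i<length es. \<forall>j\<le>i. E $$ (i, j) = 0"
    and P: "hmat n 0 ?ts es P" and Q: "hmat n 0 es ?ts Q" and s: "hmat n (- 2) es es s"
    and PD: "P * ?D = E * P" and QE: "Q * E = ?D * Q" and QP: "Q * P = 1\<^sub>m (length ?ts)"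
    and h: "E * s + s * E + P * Q = 1\<^sub>m (length es)"
    using flag_D_matrix[OF assms, of c, where 'k = 'k] by blast
  note C = hmat_carrier[OF E(1)] hmat_carrier[OF P] hmat_carrier[OF Q] hmat_carrier[OF s] hmat_carrier[OF hD]
  let ?F = "matrix_dmod n es E"
  have flag: "free_flag n 2 ?F" using E by (intro free_flag_matrix_dmod) auto
  then have F: "diff_module n 2 ?F" by (simp add: free_flag_def)
  have p: "dm_morphism n ?M ?F (\<lambda>v. P *\<^sub>v v)" and q: "dm_morphism n ?F ?M (\<lambda>v. Q *\<^sub>v v)"
    unfolding Dn_def
    by (rule dm_morphism_matrix_dmod[OF P C(5) C(1) PD], rule dm_morphism_matrix_dmod[OF Q C(1) C(5) QE])
  have qp: "Q *\<^sub>v (P *\<^sub>v x) = x" if "x \<in> carrier ?M" for x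
  proof -
    have x: "x \<in> carrier_vec (length ?ts)" using that by (simp add: Dn_def matrix_dmod_carrier_vec)
    show ?thesis unfolding assoc_mult_mat_vec[OF C(3,2) x, symmetric] QP using x by simp
  qed
  have "quasi_iso n ?F ?M (\<lambda>v. Q *\<^sub>v v)"
  proof (rule quasi_iso_homotopy_equivalence[OF F M q p qp, where s = "\<lambda>v. s *\<^sub>v v"])
    show "s *\<^sub>v x \<in> carrier ?F" if "x \<in> carrier ?F" for x
      using that by (rule hmat_mult_carrier[OF s])
    show "s *\<^sub>v \<zero>\<^bsub>?F\<^esub> = \<zero>\<^bsub>?F\<^esub>" using C(4) by (intro eq_vecI) auto
    fix x assume "x \<in> carrier ?F"
    then have x: "x \<in> carrier_vec (length es)" by (rule matrix_dmod_carrier_vec)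
    have "x = (E * s + s * E + P * Q) *\<^sub>v x" using x by (simp add: h)
    also have "\<dots> = E *\<^sub>v (s *\<^sub>v x) + s *\<^sub>v (E *\<^sub>v x) + P *\<^sub>v (Q *\<^sub>v x)"
      using C x by (simp add: add_mult_distrib_mat_vec[of _ "length es" "length es"]
          assoc_mult_mat_vec[of _ "length es" "length es"] assoc_mult_mat_vec[of _ "length es" "length ?ts"])
    finally show "x = differential ?F (s *\<^sub>v x) \<oplus>\<^bsub>?F\<^esub> s *\<^sub>v (differential ?F x) \<oplus>\<^bsub>?F\<^esub> P *\<^sub>v (Q *\<^sub>v x)"
      by simp
  qed
  then have res: "free_flag_resolution n 2 ?F ?M (\<lambda>v. Q *\<^sub>v v)"
    using flag M by (simp add: free_flag_resolution_def)
  have split: "split_injection n ?M ?F (\<lambda>v. P *\<^sub>v v)"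
    unfolding split_injection_def using p q qp by auto
  \<comment> \<open>The identity of D_n factors through the flag as \<open>Q\<close> after
    \<open>P\<close>.\<close>
  show "minimal_free_resolution TYPE('k mpoly vec) n 2 ?M ?M (\<lambda>x. x)"
    unfolding minimal_free_resolution_def
    using minimal quasi_iso_id[OF M] res split qp by force
qed

end
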